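(* Let $\mathfrak g$ be a simple Lie algebra over $\Bbbk$ and let $\vartheta$ be an inner automorphism of $\mathfrak g$ of finite order that is $\mathcal N$-regular, with Kac labels $p_i=p_i(\vartheta)$, $i=0,1,\dots,l$. Then (i) $p_i\in\{0,1\}$ for all $i$ such that $n_i>1$; (ii) if $p_i>1$ for some $i$ such that $n_i=1$, then $p_j=1$ for all other $j$.
   Context: $\Bbbk$ is an algebraically closed field of characteristic $0$. Kac labels of inner periodic automorphisms. Let $\mathfrak g$ be simple, $l=\operatorname{rk}\mathfrak g$, $\mathfrak t$ a Cartan subalgebra, $\Delta$ the root system, $\Pi=\{\alpha_1,\dots,\alpha_l\}$ a set of simple roots, $\mathfrak g^\gamma$ the root space of $\gamma\in\Delta$, $\delta=\sum_{i=1}^l n_i\alpha_i$ the highest root, $\alpha_0=-\delta$, $n_0=1$. Write $[\gamma:\alpha_i]$ for the coefficient of $\alpha_i$ in $\gamma$. Let $\boldsymbol p=(p_0,\dots,p_l)\ne(0,\dots,0)$ be nonnegative integers with $\gcd(p_0,\dots,p_l)=1$, and put $m=\sum_{i=0}^l n_ip_i$. The automorphism $\vartheta(\boldsymbol p)$, of order $m$, is the inner automorphism acting trivially on $\mathfrak t$ and as multiplication by $\zeta^{d(\gamma)}$ on $\mathfrak g^\gamma$, where $d(\gamma)=\sum_{i=1}^l[\gamma:\alpha_i]p_i$ and $\zeta$ is a fixed primitive $m$-th root of unity; every inner automorphism of finite order is conjugate to one of this form, and the $p_i$ are its Kac labels. For an automorphism $\vartheta$ of order $m$, $\mathfrak g_i$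 denotes the $\zeta^i$-eigenspace of $\vartheta$. $\vartheta$ is $\mathcal N$-regular if $\mathfrak g_1$ contains a regular nilpotent element of $\mathfrak g$. *)

theory Defs
  imports "HOL-Computational_Algebra.Polynomial"
begin

text \<open>\<open>root_coeff t l \<alpha> \<gamma> i\<close> is the coefficient \<open>[\<gamma> : \<alpha> i]\<close> of \<open>\<alpha> i\<close> in the root \<open>\<gamma>\<close>.\<close>
definition root_coeff :: "'g set \<Rightarrow> nat \<Rightarrow> (nat \<Rightarrow> 'g \<Rightarrow> 'k::field) \<Rightarrow> ('g \<Rightarrow> 'k) \<Rightarrow> nat \<Rightarrow> int" where
  "root_coeff t l \<alpha> \<gamma> = (THE c. (\<forall>i. i \<notin> {1..l} \<longrightarrow> c i = 0) \<and>
     (\<forall>h\<in>t. \<gamma> h = (\<Sum>i=1..l. of_int (c i) * \<alpha> i h)))"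

text \<open>The numbers \<open>n 0 = 1\<close> and \<open>n i = [\<delta> : \<alpha> i]\<close> for \<open>1 \<le> i \<le> l\<close>; the latter are
  nonnegative, so that truncation by \<open>nat\<close> loses nothing.\<close>
definition mark :: "'g set \<Rightarrow> nat \<Rightarrow> (nat \<Rightarrow> 'g \<Rightarrow> 'k::field) \<Rightarrow> ('g \<Rightarrow> 'k) \<Rightarrow> nat \<Rightarrow> nat" where
  "mark t l \<alpha> \<delta> i = (if i = 0 then 1 else nat (root_coeff t l \<alpha> \<delta> i))"

definition kac_degree :: "'g set \<Rightarrow> nat \<Rightarrow> (nat \<Rightarrow> 'g \<Rightarrow> 'k::field) \<Rightarrow> (nat \<Rightarrow> nat) \<Rightarrow> ('g \<Rightarrow> 'k) \<Rightarrow> int" where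
  "kac_degree t l \<alpha> p \<gamma> = (\<Sum>i=1..l. root_coeff t l \<alpha> \<gamma> i * int (p i))"

definition has_order :: "('a \<Rightarrow> 'a) \<Rightarrow> nat \<Rightarrow> bool" where
  "has_order \<phi> m \<longleftrightarrow> m > 0 \<and> \<phi> ^^ m = id \<and> (\<forall>k. 0 < k \<and> k < m \<longrightarrow> \<phi> ^^ k \<noteq> id)"

definition primitive_root_of_unity :: "nat \<Rightarrow> 'k::field \<Rightarrow> bool" where
  "primitive_root_of_unity m \<zeta> \<longleftrightarrow> m > 0 \<and> \<zeta> ^ m = 1 \<and> (\<forall>k. 0 < k \<and> k < m \<longrightarrow> \<zeta> ^ k \<noteq> 1)"

locale lie_algebra = vector_space scale
  for scale :: "'k::field \<Rightarrow> 'g::ab_group_add \<Rightarrow> 'g" (infixr "*s" 75) +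
  fixes br :: "'g \<Rightarrow> 'g \<Rightarrow> 'g"
  assumes br_add_left: "br (x + y) z = br x z + br y z"
    and br_add_right: "br x (y + z) = br x y + br x z"
    and br_scale_left: "br (c *s x) y = c *s br x y"
    and br_scale_right: "br x (c *s y) = c *s br x y"
    and br_self: "br x x = 0"
    and jacobi: "br x (br y z) + br y (br z x) + br z (br x y) = 0"
begin

definition ideal :: "'g set \<Rightarrow> bool" where
  "ideal I \<longleftrightarrow> subspace I \<and> (\<forall>x. \<forall>y\<in>I. br x y \<in> I)"

definition subalgebra :: "'g set \<Rightarrow> bool" where
  "subalgebra S \<longleftrightarrow> subspace S \<and> (\<forall>x\<in>S. \<forall>y\<in>S. br x y \<in> S)"

primrec lower_central :: "'g set \<Rightarrow> nat \<Rightarrow> 'g set" where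
  "lower_central S 0 = S"
| "lower_central S (Suc n) = span {br x y | x y. x \<in> S \<and> y \<in> lower_central S n}"

definition normalizer :: "'g set \<Rightarrow> 'g set" where
  "normalizer S = {x. \<forall>y\<in>S. br x y \<in> S}"

definition centralizer :: "'g \<Rightarrow> 'g set" where
  "centralizer x = {y. br x y = 0}"

definition cartan_subalgebra :: "'g set \<Rightarrow> bool" where
  "cartan_subalgebra t \<longleftrightarrow>
     subalgebra t \<and> (\<exists>n. lower_central t n = {0}) \<and> normalizer t = t"

definition ad_nilpotent :: "'g \<Rightarrow> bool" where
  "ad_nilpotent x \<longleftrightarrow> (\<exists>n. \<forall>y. (br x ^^ n) y = 0)"

definition regular :: "'g \<Rightarrow> bool" where
  "regular x \<longleftrightarrow> (\<forall>y. dim (centralizer x) \<le> dim (centralizer y))"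

definition regular_nilpotent :: "'g \<Rightarrow> bool" where
  "regular_nilpotent x \<longleftrightarrow> ad_nilpotent x \<and> regular x"

definition lie_automorphism :: "('g \<Rightarrow> 'g) \<Rightarrow> bool" where
  "lie_automorphism \<phi> \<longleftrightarrow>
     Vector_Spaces.linear scale scale \<phi> \<and> bij \<phi> \<and> (\<forall>x y. \<phi> (br x y) = br (\<phi> x) (\<phi> y))"

text \<open>The exponential series of \<open>ad x\<close>; only used for ad-nilpotent \<open>x\<close>, where the
  index set below is finite.\<close>
definition exp_ad :: "'g \<Rightarrow> 'g \<Rightarrow> 'g" where
  "exp_ad x y = (\<Sum>k\<in>{k. (br x ^^ k) y \<noteq> 0}. inverse (of_nat (fact k)) *s (br x ^^ k) y)"

text \<open>The group generated by all \<open>exp (ad x)\<close> with \<open>x\<close> ad-nilpotent. It is closed under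
  inverses because \<open>exp (ad (- x))\<close> is inverse to \<open>exp (ad x)\<close>.\<close>
inductive inner_automorphism :: "('g \<Rightarrow> 'g) \<Rightarrow> bool" where
  inner_id: "inner_automorphism id"
| inner_exp: "ad_nilpotent x \<Longrightarrow> inner_automorphism \<phi> \<Longrightarrow> inner_automorphism (exp_ad x \<circ> \<phi>)"

text \<open>Linear forms on \<open>t\<close> are represented by functions on the whole algebra that vanish
  outside the set \<open>t\<close>, so that equality of forms is equality of functions.\<close>
definition dual_space :: "'g set \<Rightarrow> ('g \<Rightarrow> 'k) set" where
  "dual_space t = {f. (\<forall>x\<in>t. \<forall>y\<in>t. f (x + y) = f x + f y) \<and>
                      (\<forall>c. \<forall>x\<in>t. f (c *s x) = c * f x) \<and> (\<forall>x. x \<notin> t \<longrightarrow> f x = 0)}"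

definition root_space :: "'g set \<Rightarrow> ('g \<Rightarrow> 'k) \<Rightarrow> 'g set" where
  "root_space t \<gamma> = {x. \<forall>h\<in>t. br h x = \<gamma> h *s x}"

definition roots :: "'g set \<Rightarrow> ('g \<Rightarrow> 'k) set" where
  "roots t = {\<gamma> \<in> dual_space t. \<gamma> \<noteq> (\<lambda>_. 0) \<and> root_space t \<gamma> \<noteq> {0}}"

text \<open>\<open>\<alpha> 1, \<dots>, \<alpha> l\<close> form a basis of the dual of \<open>t\<close>, and every root is an integral
  combination of them with all coefficients of one sign.\<close>
definition simple_roots :: "'g set \<Rightarrow> nat \<Rightarrow> (nat \<Rightarrow> 'g \<Rightarrow> 'k) \<Rightarrow> bool" where
  "simple_roots t l \<alpha> \<longleftrightarrow>
     (\<forall>i\<in>{1..l}. \<alpha> i \<in> roots t) \<and>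
     (\<forall>c. (\<forall>h\<in>t. (\<Sum>i=1..l. c i * \<alpha> i h) = 0) \<longrightarrow> (\<forall>i\<in>{1..l}. c i = 0)) \<and>
     (\<forall>f\<in>dual_space t. \<exists>c. \<forall>h\<in>t. f h = (\<Sum>i=1..l. c i * \<alpha> i h)) \<and>
     (\<forall>\<gamma>\<in>roots t. \<exists>c :: nat \<Rightarrow> int. (\<forall>h\<in>t. \<gamma> h = (\<Sum>i=1..l. of_int (c i) * \<alpha> i h)) \<and>
        ((\<forall>i\<in>{1..l}. c i \<ge> 0) \<or> (\<forall>i\<in>{1..l}. c i \<le> 0)))"

text \<open>The highest root is the greatest root for the partial order in which
  \<open>\<gamma> \<le> \<delta>\<close> iff \<open>\<delta> - \<gamma>\<close> is a nonnegative combination of simple roots.\<close>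
definition highest_root :: "'g set \<Rightarrow> nat \<Rightarrow> (nat \<Rightarrow> 'g \<Rightarrow> 'k) \<Rightarrow> ('g \<Rightarrow> 'k) \<Rightarrow> bool" where
  "highest_root t l \<alpha> \<delta> \<longleftrightarrow> \<delta> \<in> roots t \<and>
     (\<forall>\<gamma>\<in>roots t. \<forall>i\<in>{1..l}. root_coeff t l \<alpha> \<gamma> i \<le> root_coeff t l \<alpha> \<delta> i)"

text \<open>\<open>\<theta>\<close> is the automorphism \<open>\<vartheta>(p)\<close> determined by \<open>\<zeta>\<close>. The degree of a root may be negative,
  hence the integer power.\<close>
definition kac_automorphism ::
    "'g set \<Rightarrow> nat \<Rightarrow> (nat \<Rightarrow> 'g \<Rightarrow> 'k) \<Rightarrow> 'k \<Rightarrow> (nat \<Rightarrow> nat) \<Rightarrow> ('g \<Rightarrow> 'g) \<Rightarrow> bool" where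
  "kac_automorphism t l \<alpha> \<zeta> p \<theta> \<longleftrightarrow> inner_automorphism \<theta> \<and> (\<forall>x\<in>t. \<theta> x = x) \<and>
     (\<forall>\<gamma>\<in>roots t. \<forall>x\<in>root_space t \<gamma>. \<theta> x = (\<zeta> powi kac_degree t l \<alpha> p \<gamma>) *s x)"

definition eigenspace :: "'k \<Rightarrow> ('g \<Rightarrow> 'g) \<Rightarrow> nat \<Rightarrow> 'g set" where
  "eigenspace \<zeta> \<theta> i = {x. \<theta> x = (\<zeta> ^ i) *s x}"

definition N_regular :: "'k \<Rightarrow> ('g \<Rightarrow> 'g) \<Rightarrow> bool" where
  "N_regular \<zeta> \<theta> \<longleftrightarrow> (\<exists>x \<in> eigenspace \<zeta> \<theta> 1. regular_nilpotent x)"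

text \<open>\<open>p 0, \<dots>, p l\<close> are Kac labels of \<open>\<theta>\<close> (with respect to \<open>t\<close>, the simple roots \<open>\<alpha>\<close> and \<open>\<zeta>\<close>) if
  \<open>\<theta>\<close> is conjugate to \<open>\<vartheta>(p)\<close> in the automorphism group. They are only determined up to
  symmetries of the affine Dynkin diagram, hence a predicate.\<close>
definition kac_labels ::
    "'g set \<Rightarrow> nat \<Rightarrow> (nat \<Rightarrow> 'g \<Rightarrow> 'k) \<Rightarrow> ('g \<Rightarrow> 'k) \<Rightarrow> 'k \<Rightarrow> (nat \<Rightarrow> nat) \<Rightarrow> ('g \<Rightarrow> 'g) \<Rightarrow> bool" where
  "kac_labels t l \<alpha> \<delta> \<zeta> p \<theta> \<longleftrightarrow>
     (\<exists>i\<in>{0..l}. p i \<noteq> 0) \<and> Gcd (p ` {0..l}) = 1 \<and>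
     primitive_root_of_unity (\<Sum>i=0..l. mark t l \<alpha> \<delta> i * p i) \<zeta> \<and>
     (\<exists>\<theta>\<^sub>p \<phi>. kac_automorphism t l \<alpha> \<zeta> p \<theta>\<^sub>p \<and> lie_automorphism \<phi> \<and> \<theta> = \<phi> \<circ> \<theta>\<^sub>p \<circ> inv \<phi>)"

end

locale simple_lie_algebra = lie_algebra +
  assumes finite_dimensional: "\<exists>B. finite B \<and> span B = UNIV"
    and nonabelian: "\<exists>x y. br x y \<noteq> 0"
    and simple: "ideal I \<Longrightarrow> I = {0} \<or> I = UNIV"

end

theory Submission
  imports Defs
begin

text \<open>After conjugation let \<open>e \<in> g\<^sub>1\<close> be a regular nilpotent element for \<open>\<vartheta>(p)\<close>. If \<open>p i > 1\<close>, every
  affine root occurring in \<open>e\<close> is a combination of the affine simple roots other than \<open>\<alpha> i\<close>, so \<open>e\<close>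
  has degree 1 in the \<open>\<int>\<close>-grading that gives these simple roots their labels as degrees. Since \<open>ad e\<close>
  raises the degree by one, its kernel is at least as large as the part of degree 0, in any graded
  subalgebra that contains \<open>e\<close> and \<open>t\<close>. If \<open>n i > 1\<close>, or if another label exceeds 1, then \<open>e\<close> lies in
  a proper such subalgebra, and the nilpotent \<open>ad e\<close> has a further kernel on a complement; if another
  label is 0, the part of degree 0 is larger than \<open>t\<close>. In each case the centralizer of \<open>e\<close> has dimension
  greater than that of \<open>t\<close>, although it is at most \<open>dim t\<close> by regularity.

  The root space decomposition comes from the nondegeneracy of the Killing form, which is immediate
  here because all weights of \<open>t\<close> are integral combinations of the simple roots.\<close>

section \<open>Generalized eigenspaces and the trace\<close>

text \<open>Two elements of \<open>t\<close> steer the dimension count: \<open>y\<close> measures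
  the degree, and \<open>u\<close> selects the weights \<gamma> with \<gamma>(u) integral, a
  condition stable under addition. The affine simple roots satisfy the relation that the sum of all
  n_k \<alpha>_k is 0, whereas the labels give the sum m. If every other affine simple root keeps
  its label as value at \<open>y\<close>, then \<alpha>_i must take the value p_i - m/n_i. This is a
  fraction in general, which is why only weights with natural numbers as values at \<open>y\<close>
  are counted. The element \<open>u\<close> is integral at all roots occurring in \<open>e\<close>,
  yet takes a value of the form 1/n_i or 1/2, up to sign, at some simple root; this makes the
  selected part proper. A label above 1 drops out of \<open>e\<close> for a numerical reason: the
  degree 1 is a sum of labels with nonnegative coefficients. On the way from the Killing form to
  root spaces the obstacle is that \<open>t\<close> is only known to be nilpotent and
  self-normalizing, so neither commutativity nor diagonal action is given. Both are derived from the
  simple roots, the latter by comparing traces of \<open>ad h\<close> with those of its semisimple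
  part.\<close>

locale endo_space = finite_dimensional_vector_space scale Basis
  for scale :: "'k::{alg_closed_field, field_char_0} \<Rightarrow> 'g::ab_group_add \<Rightarrow> 'g" (infixr "*s" 75)
    and Basis :: "'g set"
begin

sublocale endo: finite_dimensional_vector_space_pair scale Basis scale Basis
  by unfold_locales

abbreviation lin :: "('g \<Rightarrow> 'g) \<Rightarrow> bool" where
  "lin \<equiv> Vector_Spaces.linear scale scale"

definition shift :: "('g \<Rightarrow> 'g) \<Rightarrow> 'k \<Rightarrow> 'g \<Rightarrow> 'g" where
  "shift f a x = f x - a *s x"

definition gen_eigenspace :: "('g \<Rightarrow> 'g) \<Rightarrow> 'k \<Rightarrow> 'g set" where
  "gen_eigenspace f a = {x. \<exists>n. (shift f a ^^ n) x = 0}"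

lemma linI:
  assumes "\<And>x y. f (x + y) = f x + f y" and "\<And>c x. f (c *s x) = c *s f x"
  shows "lin f"
  using assms by (simp add: Vector_Spaces.linear_iff vector_space_axioms)

lemma lin_compose: "lin f \<Longrightarrow> lin g \<Longrightarrow> lin (\<lambda>x. f (g x))"
  by (rule linI) (simp_all add: endo.linear_add endo.linear_scale)

lemma lin_funpow: "lin f \<Longrightarrow> lin (f ^^ n)"
proof (induction n)
  case 0
  show ?case
    by (rule linI) simp_all
next
  case (Suc n)
  then show ?case
    using lin_compose[of f "f ^^ n"] by (simp add: o_def)
qed

lemma lin_shift: "lin f \<Longrightarrow> lin (shift f a)"
  by (rule linI) (simp_all add: shift_def endo.linear_add endo.linear_scale scale_right_distrib
      scale_right_diff_distrib scale_left_commute)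

lemma shift_in_subspace:
  "subspace U \<Longrightarrow> f x \<in> U \<Longrightarrow> x \<in> U \<Longrightarrow> shift f a x \<in> U"
  by (simp add: shift_def subspace_diff subspace_scale)

lemma funpow_closed: "(\<And>x. x \<in> U \<Longrightarrow> f x \<in> U) \<Longrightarrow> x \<in> U \<Longrightarrow> (f ^^ n) x \<in> U"
  by (induction n) auto

lemma funpow_commute: "(\<And>x. f (g x) = g (f x)) \<Longrightarrow> (f ^^ n) (g x) = g ((f ^^ n) x)"
  by (induction n) auto

lemma funpow_lin_zero: "lin f \<Longrightarrow> (f ^^ n) x = 0 \<Longrightarrow> n \<le> m \<Longrightarrow> (f ^^ m) x = 0"
proof -
  assume a: "lin f" "(f ^^ n) x = 0" "n \<le> m"
  then have "(f ^^ m) x = (f ^^ (m - n)) ((f ^^ n) x)"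
    by (metis comp_apply funpow_add le_add_diff_inverse2)
  then show ?thesis
    using a endo.linear_0[OF lin_funpow[OF a(1)]] by simp
qed

lemma subspace_locally_nilpotent:
  assumes "lin f"
  shows "subspace {x. \<exists>n. (f ^^ n) x = 0}"
proof (rule subspaceI)
  show "0 \<in> {x. \<exists>n. (f ^^ n) x = 0}"
    by (auto intro: exI[of _ 0])
next
  fix x y assume "x \<in> {x. \<exists>n. (f ^^ n) x = 0}" "y \<in> {x. \<exists>n. (f ^^ n) x = 0}"
  then obtain n m where "(f ^^ n) x = 0" "(f ^^ m) y = 0"
    by auto
  then have "(f ^^ max n m) x = 0" "(f ^^ max n m) y = 0"
    using funpow_lin_zero[OF assms] by auto
  then have "(f ^^ max n m) (x + y) = 0"
    using endo.linear_add[OF lin_funpow[OF assms]] by simp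
  then show "x + y \<in> {x. \<exists>n. (f ^^ n) x = 0}"
    by blast
next
  fix c x assume "x \<in> {x. \<exists>n. (f ^^ n) x = 0}"
  then show "c *s x \<in> {x. \<exists>n. (f ^^ n) x = 0}"
    using endo.linear_scale[OF lin_funpow[OF assms]] by auto
qed

lemma subspace_gen_eigenspace: "lin f \<Longrightarrow> subspace (gen_eigenspace f a)"
  unfolding gen_eigenspace_def by (rule subspace_locally_nilpotent[OF lin_shift])

lemma gen_eigenspace_closed:
  assumes "lin g" and "\<And>x. f (g x) = g (f x)" and "x \<in> gen_eigenspace f a"
  shows "g x \<in> gen_eigenspace f a"
proof -
  have c: "shift f a (g x) = g (shift f a x)" for x
    using assms(1,2) by (simp add: shift_def endo.linear_diff endo.linear_scale)
  obtain n where "(shift f a ^^ n) x = 0"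
    using assms(3) by (auto simp: gen_eigenspace_def)
  then have "(shift f a ^^ n) (g x) = 0"
    using funpow_commute[of "shift f a" g, OF c] endo.linear_0[OF assms(1)] by simp
  then show ?thesis
    by (auto simp: gen_eigenspace_def)
qed

lemma eigenvector_in_gen_eigenspace: "f x = a *s x \<Longrightarrow> x \<in> gen_eigenspace f a"
  by (auto simp: gen_eigenspace_def shift_def intro!: exI[of _ 1])

section \<open>Annihilating polynomials and generalized eigenspaces\<close>

definition poly_act :: "'k poly \<Rightarrow> ('g \<Rightarrow> 'g) \<Rightarrow> 'g \<Rightarrow> 'g" where
  "poly_act P f x = (\<Sum>i\<le>degree P. coeff P i *s (f ^^ i) x)"

lemma poly_act_eq_sum: "degree P \<le> n \<Longrightarrow> poly_act P f x = (\<Sum>i\<le>n. coeff P i *s (f ^^ i) x)"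
  unfolding poly_act_def
  by (rule sum.mono_neutral_left) (auto simp: coeff_eq_0)

text \<open>This peels a root \<open>a\<close> off an annihilating polynomial. Working with a degree
  bound instead of the exact degree covers \<open>Q = 0\<close> as well.\<close>

lemma poly_act_linear_factor:
  assumes "lin f"
  shows "poly_act ([:-a, 1:] * Q) f x = shift f a (poly_act Q f x)"
proof -
  have e: "[:-a, 1:] * Q = pCons 0 Q - smult a Q"
    by simp
  let ?n = "degree Q"
  have d: "degree ([:-a, 1:] * Q) \<le> Suc ?n"
    by (rule order.trans[OF degree_mult_le]) simp
  have "poly_act ([:-a, 1:] * Q) f x
      = (\<Sum>i\<le>Suc ?n. coeff (pCons 0 Q) i *s (f ^^ i) x) - (\<Sum>i\<le>Suc ?n. (a * coeff Q i) *s (f ^^ i) x)"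
    unfolding poly_act_eq_sum[OF d] unfolding e
    by (simp only: coeff_diff coeff_smult scale_left_diff_distrib sum_subtractf)
  also have "(\<Sum>i\<le>Suc ?n. coeff (pCons 0 Q) i *s (f ^^ i) x) = (\<Sum>i\<le>?n. coeff Q i *s (f ^^ Suc i) x)"
    by (subst sum.atMost_Suc_shift) simp
  also have "\<dots> = f (poly_act Q f x)"
    by (simp add: poly_act_def endo.linear_sum[OF assms] endo.linear_scale[OF assms])
  also have "(\<Sum>i\<le>Suc ?n. (a * coeff Q i) *s (f ^^ i) x) = a *s poly_act Q f x"
    by (simp add: poly_act_eq_sum[of Q "Suc ?n"] scale_sum_right coeff_eq_0)
  finally show ?thesis
    by (simp add: shift_def)
qed

lemma poly_act_in_subspace:
  "subspace U \<Longrightarrow> (\<And>x. x \<in> U \<Longrightarrow> f x \<in> U) \<Longrightarrow> x \<in> U \<Longrightarrow> poly_act P f x \<in> U"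
  unfolding poly_act_def by (intro subspace_sum subspace_scale funpow_closed)

text \<open>The iterates of \<open>x\<close> up to the exponent \<open>card Basis\<close> are one
  vector too many to be independent. A polynomial for the single vector \<open>x\<close> suffices
  for finding eigenvectors.\<close>

lemma annihilating_poly:
  shows "\<exists>P. P \<noteq> 0 \<and> poly_act P f x = 0"
proof -
  let ?N = "card Basis" and ?v = "\<lambda>i. (f ^^ i) x"
  have "\<exists>c. (\<exists>i\<le>?N. c i \<noteq> 0) \<and> (\<Sum>i\<le>?N. c i *s ?v i) = 0"
  \<comment> \<open>\<open>dependent\<close> speaks of the set of iterates, which may be too small
    if two of them coincide. A coincidence is itself a relation, with coefficients 1 and -1.\<close>
  proof (cases "inj_on ?v {..?N}")
    case True
    have "dependent (?v ` {..?N})"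
      using independent_card_le_dim[of "?v ` {..?N}" UNIV] True by (auto simp: card_image)
    then obtain u where u: "(\<Sum>v\<in>?v ` {..?N}. u v *s v) = 0" "\<exists>v\<in>?v ` {..?N}. u v \<noteq> 0"
      using dependent_finite[of "?v ` {..?N}"] by auto
    then have "(\<Sum>i\<le>?N. u (?v i) *s ?v i) = 0"
      using sum.reindex[OF True, of "\<lambda>v. u v *s v"] by simp
    then show ?thesis
      using u(2) by (intro exI[of _ "\<lambda>i. u (?v i)"]) auto
  next
    case False
    then obtain i j where ij: "i \<le> ?N" "j \<le> ?N" "i \<noteq> j" "?v i = ?v j"
      by (auto simp: inj_on_def)
    let ?c = "\<lambda>k. (if k = i then 1 else 0) - (if k = j then 1 else 0) :: 'k"
    have "(\<Sum>k\<le>?N. ?c k *s ?v k)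
        = (\<Sum>k\<le>?N. if k = i then ?v k else 0) - (\<Sum>k\<le>?N. if k = j then ?v k else 0)"
      unfolding sum_subtractf[symmetric] by (rule sum.cong) (auto simp: scale_left_diff_distrib)
    also have "\<dots> = 0"
      using ij by (simp add: sum.delta)
    finally show ?thesis
      using ij by (intro exI[of _ ?c]) auto
  qed
  then obtain c i where c: "i \<le> ?N" "c i \<noteq> 0" "(\<Sum>i\<le>?N. c i *s ?v i) = 0"
    by blast
  let ?P = "\<Sum>i\<le>?N. monom (c i) i"
  have co: "coeff ?P k = (if k \<le> ?N then c k else 0)" for k
    by (simp add: coeff_sum sum.delta)
  have "degree ?P \<le> ?N"
    by (rule degree_le) (simp add: co)
  then have "poly_act ?P f x = 0"
    using c(3) by (simp add: poly_act_eq_sum co)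
  moreover have "?P \<noteq> 0"
    using co[of i] c by auto
  ultimately show ?thesis
    by blast
qed

text \<open>Induction on the degree of a polynomial that carries \<open>x\<close> into
  \<open>E\<close>: after splitting off a root \<open>a\<close>, either the cofactor already carries
  \<open>x\<close> into \<open>E\<close>, or its value at \<open>x\<close> is the wanted vector. For
  \<open>E = {0}\<close> this is an ordinary eigenvector in \<open>U\<close>.\<close>

lemma eigenvector_modulo_subspace:
  assumes f: "lin f" and E: "subspace E" and U: "subspace U" "\<And>x. x \<in> U \<Longrightarrow> f x \<in> U"
    and x: "x \<in> U" "x \<notin> E"
  shows "\<exists>a. \<exists>y\<in>U - E. shift f a y \<in> E"
proof -
  have "\<exists>a. \<exists>y\<in>U - E. shift f a y \<in> E" if "P \<noteq> 0" "poly_act P f x \<in> E" for P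
    using that
  proof (induction "degree P" arbitrary: P)
    case 0
    then obtain c where c: "P = [:c:]" "c \<noteq> 0"
      by (metis degree_eq_zeroE pCons_0_0)
    then have "c *s x \<in> E"
      using 0 by (simp add: poly_act_def)
    then have "inverse c *s c *s x \<in> E"
      by (rule subspace_scale[OF E])
    then show ?case
      using c x by simp
  next
    case (Suc n)
    then obtain a where "poly P a = 0"
      using alg_closed_imp_poly_has_root[of P] by auto
    then obtain Q where Q: "P = [:-a, 1:] * Q"
      by (auto simp: poly_eq_0_iff_dvd)
    have "Q \<noteq> 0"
      using Suc Q by auto
    then have "degree P = Suc (degree Q)"
      unfolding Q by (subst degree_mult_eq) auto
    show ?case
    proof (cases "poly_act Q f x \<in> E")
      case True
      then show ?thesis
        using Suc \<open>Q \<noteq> 0\<close> \<open>degree P = _\<close> by auto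
    next
      case False
      moreover have "poly_act Q f x \<in> U"
        by (rule poly_act_in_subspace[OF U x(1)])
      moreover have "shift f a (poly_act Q f x) \<in> E"
        using Suc(4) poly_act_linear_factor[OF f] unfolding Q by simp
      ultimately show ?thesis
        by blast
    qed
  qed
  then show ?thesis
    using annihilating_poly[of f x] subspace_0[OF E] by auto
qed

text \<open>On this subspace f - a is the nonzero scalar b - a plus the locally nilpotent f - b. A
  preimage is built by induction on the number of steps in which f - b kills
  \<open>x\<close>.\<close>

lemma shift_surj_gen_eigenspace:
  assumes f: "lin f" and U: "subspace U" "\<And>x. x \<in> U \<Longrightarrow> f x \<in> U" and "a \<noteq> b"
    and x: "x \<in> gen_eigenspace f b \<inter> U"
  shows "\<exists>y\<in>gen_eigenspace f b \<inter> U. x = shift f a y"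
proof -
  have "\<exists>y\<in>gen_eigenspace f b \<inter> U. x = shift f a y"
    if "(shift f b ^^ n) x = 0" "x \<in> gen_eigenspace f b \<inter> U" for n x
    using that
  proof (induction n arbitrary: x)
    case 0
    then show ?case
      using subspace_0[OF U(1)] subspace_0[OF subspace_gen_eigenspace[OF f]]
      by (intro bexI[of _ 0]) (auto simp: shift_def endo.linear_0[OF f])
  next
    case (Suc n)
    have sub: "subspace (gen_eigenspace f b \<inter> U)"
      by (intro subspace_inter subspace_gen_eigenspace U f)
    have "shift f b x \<in> gen_eigenspace f b \<inter> U"
      using Suc.prems(2) gen_eigenspace_closed[OF f, of f x b] U
        subspace_gen_eigenspace[OF f]
      by (auto intro!: shift_in_subspace)
    moreover have "(shift f b ^^ n) (shift f b x) = 0"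
      using Suc.prems(1) by (simp add: funpow_swap1)
    ultimately obtain y where y: "y \<in> gen_eigenspace f b \<inter> U" "shift f b x = shift f a y"
      using Suc.IH by blast
    \<comment> \<open>If (f - b) x = (f - a) y, then (f - a)(x - y) = (f - a) x - (f - b) x = (b -
      a) x.\<close>
    have "shift f a (inverse (b - a) *s (x - y)) = inverse (b - a) *s (shift f a x - shift f a y)"
      using lin_shift[OF f] by (simp add: endo.linear_scale endo.linear_diff)
    also have "shift f a x - shift f a y = (b - a) *s x"
      unfolding y(2)[symmetric] by (simp add: shift_def scale_left_diff_distrib)
    finally have "shift f a (inverse (b - a) *s (x - y)) = x"
      using \<open>a \<noteq> b\<close> by simp
    moreover have "inverse (b - a) *s (x - y) \<in> gen_eigenspace f b \<inter> U"
      using sub Suc.prems(2) y(1) by (intro subspace_scale subspace_diff)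
    ultimately show ?case
      by force
  qed
  then show ?thesis
    using x by (auto simp: gen_eigenspace_def)
qed

text \<open>A vector y of \<open>U\<close> outside the span, with (f - a) y inside it, is corrected
  by some v of the span until (f - a)(y - v) is a generalized a-eigenvector. Then so is y - v, which
  forces y into the span.\<close>

lemma gen_eigenspace_span:
  assumes f: "lin f" and U: "subspace U" "\<And>x. x \<in> U \<Longrightarrow> f x \<in> U"
  shows "U \<subseteq> span (\<Union>a. gen_eigenspace f a \<inter> U)"
proof (rule ccontr)
  let ?E = "span (\<Union>a. gen_eigenspace f a \<inter> U)"
  assume "\<not> U \<subseteq> ?E"
  then obtain a y where y: "y \<in> U" "y \<notin> ?E" "shift f a y \<in> ?E"
    using eigenvector_modulo_subspace[OF f subspace_span U] by blast
  let ?G = "\<lambda>b. gen_eigenspace f b \<inter> U"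
  have sub: "subspace (?G b)" for b
    by (intro subspace_inter subspace_gen_eigenspace U f)
  \<comment> \<open>Summands for eigenvalues other than \<open>a\<close> lie in the image of f - a,
    so modulo this image only the \<open>a\<close>-part of \<open>z\<close> survives.\<close>
  have "\<exists>v\<in>?E. z - shift f a v \<in> ?G a" if "z \<in> ?E" for z
    using that
  proof (induction rule: span_induct_alt)
    case base
    then show ?case
      using subspace_0[OF sub] span_zero
      by (intro bexI[of _ 0]) (auto simp: shift_def endo.linear_0[OF f])
  next
    case (step c x z)
    then obtain v b where v: "v \<in> ?E" "z - shift f a v \<in> ?G a" and x: "x \<in> ?G b"
      by auto
    show ?case
    proof (cases "b = a")
      case True
      then have "(z - shift f a v) + c *s x \<in> ?G a"
        by (intro subspace_add[OF sub] subspace_scale[OF sub] v) (use x in auto)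
      then show ?thesis
        using v(1) by (intro bexI[of _ v]) (auto simp: algebra_simps)
    next
      case False
      then obtain w where w: "w \<in> ?G b" "x = shift f a w"
        using shift_surj_gen_eigenspace[OF f U, of a b x] x by auto
      have "w \<in> ?E"
        using w by (auto intro: span_base)
      then have "c *s w + v \<in> ?E"
        by (intro span_add span_scale v)
      moreover have "c *s x + z - shift f a (c *s w + v) = z - shift f a v"
        unfolding w using lin_shift[OF f] by (simp add: endo.linear_scale endo.linear_add)
      ultimately show ?thesis
        using v(2) by metis
    qed
  qed
  then obtain v where v: "v \<in> ?E" "shift f a (y - v) \<in> ?G a"
    using y(3) lin_shift[OF f] by (auto simp: endo.linear_diff)
  then obtain n where "(shift f a ^^ n) (shift f a (y - v)) = 0"
    by (auto simp: gen_eigenspace_def)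
  then have "(shift f a ^^ Suc n) (y - v) = 0"
    by (simp add: funpow_swap1)
  then have "y - v \<in> gen_eigenspace f a"
    unfolding gen_eigenspace_def by blast
  moreover have "?E \<subseteq> U"
    by (intro span_minimal U) auto
  then have "y - v \<in> U"
    using y(1) v(1) U(1) by (auto intro: subspace_diff)
  ultimately have "y - v \<in> ?E"
    by (auto intro: span_base)
  then have "(y - v) + v \<in> ?E"
    by (intro span_add v)
  then show False
    using y(2) by simp
qed

text \<open>On the kernel of f - a the operator f - b is the nonzero scalar a - b, so no power of it
  kills a nonzero vector there; induction lifts this to powers of f - a.\<close>

lemma gen_eigenspace_disjoint:
  assumes f: "lin f" and "a \<noteq> b" and x: "x \<in> gen_eigenspace f a" "x \<in> gen_eigenspace f b"
  shows "x = 0"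
proof -
  have *: "y = 0" if "shift f a y = 0" "y \<in> gen_eigenspace f b" for y
  proof -
    have "shift f b y = (a - b) *s y"
      using that(1) by (simp add: shift_def scale_left_diff_distrib)
    then have "(shift f b ^^ n) y = (a - b) ^ n *s y" for n
    proof (induction n)
      case (Suc n)
      then show ?case
        using endo.linear_scale[OF lin_shift[OF f]] by (simp add: mult.commute)
    qed simp
    then show ?thesis
      using that(2) \<open>a \<noteq> b\<close> by (auto simp: gen_eigenspace_def)
  qed
  have cl: "shift f a y \<in> gen_eigenspace f b" if "y \<in> gen_eigenspace f b" for y
    using gen_eigenspace_closed[OF f _ that] subspace_gen_eigenspace[OF f] that
    by (auto intro!: shift_in_subspace)
  obtain n where "(shift f a ^^ n) x = 0"
    using x(1) by (auto simp: gen_eigenspace_def)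
  then show ?thesis
    using x(2)
  proof (induction n arbitrary: x)
    case (Suc n)
    then have "shift f a x = 0"
      using cl by (simp add: funpow_swap1)
    then show ?case
      using * Suc.prems by blast
  qed simp
qed

text \<open>Independence is tested on finite subfamilies because the index sets in question, all
  scalars and all weights, are not known to be finite. Zero summands are allowed.\<close>

definition direct_family :: "('i \<Rightarrow> 'g set) \<Rightarrow> 'i set \<Rightarrow> bool" where
  "direct_family E I \<longleftrightarrow> (\<forall>i\<in>I. subspace (E i)) \<and>
     (\<forall>K u. finite K \<longrightarrow> K \<subseteq> I \<longrightarrow> (\<forall>k\<in>K. u k \<in> E k) \<longrightarrow> (\<Sum>k\<in>K. u k) = 0 \<longrightarrow> (\<forall>k\<in>K. u k = 0))"

lemma direct_familyD:
  assumes "direct_family E I" "finite K" "K \<subseteq> I" "\<forall>k\<in>K. u k \<in> E k" "(\<Sum>k\<in>K. u k) = 0"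
  shows "\<forall>k\<in>K. u k = 0"
  using assms(1)[unfolded direct_family_def, THEN conjunct2, rule_format, of K u] assms(2-5) by simp

text \<open>A power of f - a that kills the term \<open>u a\<close> leaves a shorter relation. By
  induction its terms vanish, so each remaining \<open>u k\<close> lies in the generalized
  eigenspaces of both \<open>a\<close> and \<open>k\<close>.\<close>

lemma direct_family_gen_eigenspace:
  assumes f: "lin f"
  shows "direct_family (gen_eigenspace f) UNIV"
  unfolding direct_family_def
proof (intro conjI allI impI)
  show "\<forall>i\<in>UNIV. subspace (gen_eigenspace f i)"
    using subspace_gen_eigenspace[OF f] by blast
next
  fix K and u :: "'k \<Rightarrow> 'g"
  assume "finite K" "\<forall>k\<in>K. u k \<in> gen_eigenspace f k" "(\<Sum>k\<in>K. u k) = 0"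
  then show "\<forall>k\<in>K. u k = 0"
  proof (induction K arbitrary: u)
    case (insert a K)
    obtain n where n: "(shift f a ^^ n) (u a) = 0"
      using insert.prems by (auto simp: gen_eigenspace_def)
    let ?h = "shift f a ^^ n"
    have l: "lin ?h"
      by (intro lin_funpow lin_shift f)
    have "?h (\<Sum>k\<in>insert a K. u k) = 0"
      using insert.prems endo.linear_0[OF l] by simp
    then have "(\<Sum>k\<in>K. ?h (u k)) = 0"
      using insert.hyps n by (simp add: endo.linear_add[OF l] endo.linear_sum[OF l])
    moreover have "\<forall>k\<in>K. ?h (u k) \<in> gen_eigenspace f k"
    proof
      fix k assume "k \<in> K"
      show "?h (u k) \<in> gen_eigenspace f k"
        using insert.prems \<open>k \<in> K\<close> gen_eigenspace_closed[OF f, of f] subspace_gen_eigenspace[OF f]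
        by (intro funpow_closed[of "gen_eigenspace f k"] shift_in_subspace) auto
    qed
    ultimately have "\<forall>k\<in>K. ?h (u k) = 0"
      using insert.IH[of "\<lambda>k. ?h (u k)"] by blast
    then have *: "\<forall>k\<in>K. u k = 0"
      using gen_eigenspace_disjoint[OF f, of a] insert.hyps insert.prems
      by (metis (mono_tags, lifting) gen_eigenspace_def insertCI mem_Collect_eq)
    then have "u a = 0"
      using insert by simp
    then show ?case
      using * by simp
  qed simp
qed

lemma direct_family_basis:
  assumes "span (\<Union>i\<in>I. E i) = UNIV"
  obtains C where "independent C" "finite C" "C \<subseteq> (\<Union>i\<in>I. E i)" "span C = UNIV"
proof -
  obtain C where C: "C \<subseteq> (\<Union>i\<in>I. E i)" "independent C" "(\<Union>i\<in>I. E i) \<subseteq> span C"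
    using maximal_independent_subset by blast
  have "span C = UNIV"
    using span_minimal[OF C(3)] assms by auto
  then show thesis
    using that C finiteI_independent by blast
qed

text \<open>The operator is prescribed on a basis of homogeneous vectors. What has to be shown is
  that an \<open>x\<close> in \<open>E i\<close> involves only basis vectors assigned to
  \<open>i\<close>.\<close>

lemma scaling_operator:
  assumes dir: "direct_family E I" and sp: "span (\<Union>i\<in>I. E i) = UNIV"
  obtains D where "lin D" "\<And>i x. i \<in> I \<Longrightarrow> x \<in> E i \<Longrightarrow> D x = c i *s x"
proof -
  obtain C where C: "independent C" "finite C" "C \<subseteq> (\<Union>i\<in>I. E i)" "span C = UNIV"
    using direct_family_basis[OF sp] .
  then have "\<forall>b\<in>C. \<exists>i\<in>I. b \<in> E i"
    by auto
  then obtain d where d: "\<And>b. b \<in> C \<Longrightarrow> d b \<in> I \<and> b \<in> E (d b)"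
    by metis
  define D where "D = endo.construct C (\<lambda>b. c (d b) *s b)"
  have D: "lin D"
    unfolding D_def by (rule endo.linear_construct[OF C(1)])
  have Db: "D b = c (d b) *s b" if "b \<in> C" for b
    unfolding D_def using endo.construct_basis[OF C(1) that] .
  have "D x = c i *s x" if i: "i \<in> I" and x: "x \<in> E i" for i x
  proof -
    let ?r = "representation C x"
    have xs: "x = (\<Sum>b\<in>C. ?r b *s b)"
      using sum_representation_eq[OF C(1) _ C(2)] C(4) by auto
    let ?K = "insert i (d ` C)"
    let ?v = "\<lambda>k. \<Sum>b\<in>{b\<in>C. d b = k}. ?r b *s b"
    \<comment> \<open>The homogeneous components of \<open>x\<close>, with \<open>x\<close> itself
      subtracted in place \<open>i\<close>, form a relation in the direct family.\<close>
    let ?u = "\<lambda>k. ?v k - (if k = i then x else 0)"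
    have sub: "subspace (E k)" if "k \<in> I" for k
      using dir that by (auto simp: direct_family_def)
    have u1: "\<forall>k\<in>?K. ?u k \<in> E k"
    proof
      fix k assume "k \<in> ?K"
      then have k: "k \<in> I"
        using i d by auto
      have "?v k \<in> E k"
        using d by (intro subspace_sum[OF sub[OF k]] subspace_scale[OF sub[OF k]]) auto
      then show "?u k \<in> E k"
        using subspace_diff[OF sub[OF k]] x subspace_0[OF sub[OF k]] by auto
    qed
    have u2: "?K \<subseteq> I"
      using i d by auto
    have u3: "finite ?K"
      using C by simp
    have u4: "(\<Sum>k\<in>?K. ?u k) = 0"
    proof -
      have "(\<Sum>k\<in>?K. ?v k) = (\<Sum>b\<in>C. ?r b *s b)"
        using C(2) by (intro sum.group) auto
      then show ?thesis
        using xs C(2) by (simp add: sum_subtractf sum.delta)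
    qed
    have u0: "\<forall>k\<in>?K. ?u k = 0"
      by (rule direct_familyD[OF dir u3 u2 u1 u4])
    have r0: "?r b = 0" if "b \<in> C" "d b \<noteq> i" for b
    proof -
      have "?v (d b) = 0"
        using u0 that by auto
      then show ?thesis
        using independentD[OF C(1), of "{b'\<in>C. d b' = d b}" ?r b] C(2) that by auto
    qed
    have "D x = (\<Sum>b\<in>C. ?r b *s D b)"
      by (subst xs) (simp only: endo.linear_sum[OF D] endo.linear_scale[OF D])
    also have "\<dots> = (\<Sum>b\<in>C. c i *s ?r b *s b)"
    proof (rule sum.cong)
      fix b assume "b \<in> C"
      then show "?r b *s D b = c i *s ?r b *s b"
        using r0[of b] Db[of b] by (cases "d b = i") (simp_all add: scale_left_commute)
    qed simp
    also have "\<dots> = c i *s x"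
      by (subst (2) xs) (simp only: scale_sum_right)
    finally show ?thesis .
  qed
  then show thesis
    using that D by blast
qed

section \<open>The trace and its independence of the basis\<close>

definition trace :: "('g \<Rightarrow> 'g) \<Rightarrow> 'k" where
  "trace f = (\<Sum>b\<in>Basis. representation Basis (f b) b)"

text \<open>Expand each vector of \<open>Basis\<close> in \<open>C\<close> and each
  \<open>f c\<close> in \<open>Basis\<close>. The resulting double sum collapses to either diagonal
  sum, depending on the order of summation.\<close>

lemma trace_eq:
  assumes f: "lin f" and C: "independent C" "span C = UNIV"
  shows "trace f = (\<Sum>c\<in>C. representation C (f c) c)"
proof -
  have fC: "finite C"
    using C finiteI_independent by blast
  let ?r = "representation Basis" and ?s = "representation C"
  note B = independent_Basis finite_Basis span_Basis
  have xB: "x = (\<Sum>b\<in>Basis. ?r x b *s b)" for x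
    using sum_representation_eq[OF B(1) _ B(2)] B(3) by auto
  have xC: "x = (\<Sum>c\<in>C. ?s x c *s c)" for x
    using sum_representation_eq[OF C(1) _ fC] C(2) by auto
  have rs: "?r (\<Sum>x\<in>X. a x *s x) b = (\<Sum>x\<in>X. a x * ?r x b)" for X a b
    using B by (simp add: representation_sum representation_scale)
  have ss: "?s (\<Sum>x\<in>X. a x *s x) b = (\<Sum>x\<in>X. a x * ?s x b)" for X a b
    using C by (simp add: representation_sum representation_scale)
  have fx: "f b = (\<Sum>c\<in>C. ?s b c *s f c)" for b
    by (subst xC) (simp add: endo.linear_sum[OF f] endo.linear_scale[OF f])
  have "trace f = (\<Sum>b\<in>Basis. \<Sum>c\<in>C. ?s b c * ?r (f c) b)"
    unfolding trace_def
  proof (rule sum.cong)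
    fix b
    have "?r (f b) b = ?r (\<Sum>c\<in>C. ?s b c *s f c) b"
      by (rule arg_cong[OF fx, of "\<lambda>v. ?r v b"])
    also have "\<dots> = (\<Sum>c\<in>C. ?s b c * ?r (f c) b)"
      using B by (simp add: representation_sum representation_scale)
    finally show "?r (f b) b = (\<Sum>c\<in>C. ?s b c * ?r (f c) b)" .
  qed simp
  also have "\<dots> = (\<Sum>c\<in>C. \<Sum>b\<in>Basis. ?s b c * ?r (f c) b)"
    by (rule sum.swap)
  also have "\<dots> = (\<Sum>c\<in>C. ?s (f c) c)"
  proof (rule sum.cong)
    fix c
    have "?s (f c) c = ?s (\<Sum>b\<in>Basis. ?r (f c) b *s b) c"
      by (rule arg_cong[OF xB, of "\<lambda>v. ?s v c"])
    also have "\<dots> = (\<Sum>b\<in>Basis. ?s b c * ?r (f c) b)"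
      by (simp add: ss mult.commute)
    finally show "(\<Sum>b\<in>Basis. ?s b c * ?r (f c) b) = ?s (f c) c"
      by simp
  qed simp
  finally show ?thesis .
qed

lemma trace_commute:
  assumes f: "lin f" and g: "lin g"
  shows "trace (\<lambda>x. f (g x)) = trace (\<lambda>x. g (f x))"
proof -
  let ?r = "representation Basis"
  note B = independent_Basis finite_Basis span_Basis
  have *: "?r (f (g b)) b = (\<Sum>c\<in>Basis. ?r (g b) c * ?r (f c) b)" if "lin f" for f g b
  proof -
    have "g b = (\<Sum>c\<in>Basis. ?r (g b) c *s c)"
      using sum_representation_eq[OF B(1) _ B(2)] B(3) by auto
    from arg_cong[OF this, of f] have "f (g b) = (\<Sum>c\<in>Basis. ?r (g b) c *s f c)"
      by (simp only: endo.linear_sum[OF that] endo.linear_scale[OF that])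
    then show ?thesis
      using B by (simp add: representation_sum representation_scale)
  qed
  have "trace (\<lambda>x. f (g x)) = (\<Sum>b\<in>Basis. \<Sum>c\<in>Basis. ?r (g b) c * ?r (f c) b)"
    unfolding trace_def by (rule sum.cong) (simp_all add: *[OF f])
  also have "\<dots> = (\<Sum>b\<in>Basis. \<Sum>c\<in>Basis. ?r (g c) b * ?r (f b) c)"
    by (rule sum.swap)
  also have "\<dots> = trace (\<lambda>x. g (f x))"
    unfolding trace_def by (rule sum.cong) (simp_all add: *[OF g] mult.commute)
  finally show ?thesis .
qed

lemma trace_add: "trace (\<lambda>x. f x + g x) = trace f + trace g"
  unfolding trace_def using independent_Basis span_Basis
  by (simp add: representation_add sum.distrib)

lemma trace_diff: "trace (\<lambda>x. f x - g x) = trace f - trace g"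
  unfolding trace_def using independent_Basis span_Basis
  by (simp add: representation_diff sum_subtractf)

lemma trace_scale: "trace (\<lambda>x. c *s f x) = c * trace f"
  unfolding trace_def using independent_Basis span_Basis
  by (simp add: representation_scale sum_distrib_left)

text \<open>A basis is extended along the kernels of the powers of \<open>f\<close>. Since
  \<open>f\<close> maps each kernel into the previous one, a new basis vector has no component along
  itself in its image.\<close>

lemma trace_nilpotent:
  assumes f: "lin f" and nil: "\<And>x. \<exists>n. (f ^^ n) x = 0"
  shows "trace f = 0"
proof -
  have "\<exists>C. independent C \<and> span C = {x. (f ^^ n) x = 0} \<and> (\<forall>c\<in>C. representation C (f c) c = 0)" for n
  proof (induction n)
    case 0
    show ?case
      using independent_empty by (intro exI[of _ "{}"]) auto
  next
    case (Suc n)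
    then obtain C where C: "independent C" "span C = {x. (f ^^ n) x = 0}"
      "\<And>c. c \<in> C \<Longrightarrow> representation C (f c) c = 0"
      by blast
    let ?K = "{x. (f ^^ Suc n) x = 0}"
    have "C \<subseteq> ?K"
      using C(2) span_superset[of C] endo.linear_0[OF f] by auto
    then obtain C' where C': "C \<subseteq> C'" "C' \<subseteq> ?K" "independent C'" "?K \<subseteq> span C'"
      using maximal_independent_subset_extend[OF _ C(1)] by metis
    have "subspace ?K"
      by (rule endo.linear_subspace_kernel[OF lin_funpow[OF f]])
    then have "span C' = ?K"
      using C' span_minimal by blast
    moreover have "representation C' (f c) c = 0" if "c \<in> C'" for c
    proof -
      have "(f ^^ n) (f c) = 0"
        using C' that by (auto simp: funpow_swap1)
      then have *: "f c \<in> span C"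
        using C(2) by simp
      have "representation C' (f c) = representation C (f c)"
        by (rule representation_extend[OF C'(3) * C'(1)])
      then show ?thesis
        using C(3) representation_ne_zero by metis
    qed
    ultimately show ?case
      using C'(3) by blast
  qed
  moreover obtain n where n: "\<And>x. (f ^^ n) x = 0"
  proof -
    obtain d where d: "\<And>x. (f ^^ d x) x = 0"
      using nil by metis
    \<comment> \<open>The sum dominates each exponent \<open>d b\<close>, so one power kills the
      whole basis.\<close>
    let ?n = "\<Sum>b\<in>Basis. d b"
    have "(f ^^ ?n) x = 0" for x
    proof (rule endo.linear_eq_on[of "f ^^ ?n" "\<lambda>_. 0" x Basis])
      show "lin (f ^^ ?n)" "lin (\<lambda>_. 0)" "x \<in> span Basis"
        using lin_funpow[OF f] span_Basis by (auto intro: linI)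
      show "(f ^^ ?n) b = 0" if "b \<in> Basis" for b
        using funpow_lin_zero[OF f d] that by (simp add: finite_Basis member_le_sum)
    qed
    then show thesis
      using that by blast
  qed
  ultimately obtain C where "independent C" "span C = {x. (f ^^ n) x = 0}"
    "\<forall>c\<in>C. representation C (f c) c = 0"
    by blast
  moreover have "{x. (f ^^ n) x = 0} = UNIV"
    using n by blast
  ultimately show ?thesis
    using trace_eq[OF f] by simp
qed

section \<open>Dimension counts and minimal subspaces\<close>

lemma dim_le_image_kernel:
  assumes f: "lin f" and S: "subspace S"
  shows "dim S \<le> dim (f ` S) + dim {x\<in>S. f x = 0}"
proof -
  let ?K = "{x\<in>S. f x = 0}"
  obtain B where B: "B \<subseteq> ?K" "independent B" "?K \<subseteq> span B" "card B = dim ?K"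
    using basis_exists by blast
  obtain C where C: "B \<subseteq> C" "C \<subseteq> S" "independent C" "S \<subseteq> span C"
    using maximal_independent_subset_extend[of B S] B by blast
  have fC: "finite C"
    using C finiteI_independent by blast
  have "independent (f ` (C - B)) \<and> inj_on f (C - B)"
  proof -
    have k: "x = 0" if x: "x \<in> span (C - B)" "f x = 0" for x
    proof -
      have "span (C - B) \<subseteq> S"
        using C S by (intro span_minimal) auto
      then have "x \<in> span B"
        using x B by auto
      then have "representation C x = representation B x"
        by (rule representation_extend[OF C(3) _ C(1)])
      moreover have "representation C x = representation (C - B) x"
        using representation_extend[OF C(3) x(1)] by auto
      ultimately have "representation B x b = 0" for b
        using representation_ne_zero by (metis Diff_iff)
      then show "x = 0"
        using sum_representation_eq[OF B(2) \<open>x \<in> span B\<close> _ subset_refl] finite_subset[OF C(1) fC] by simp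
    qed
    then have "inj_on f (span (C - B))"
      using endo.linear_inj_on_iff_eq_0[OF f subspace_span] by blast
    moreover have "independent (C - B)"
      using C(3) independent_mono by blast
    ultimately show ?thesis
      using endo.linear_independent_injective_image[OF f] inj_on_subset span_superset by metis
  qed
  then have "card (C - B) \<le> dim (f ` S)"
    using independent_card_le_dim[of "f ` (C - B)" "f ` S"] C by (auto simp: card_image)
  moreover have "dim S = card C"
    using basis_card_eq_dim C by metis
  moreover have "card C = card (C - B) + card B"
    using C fC by (metis card_Diff_subset card_mono finite_subset le_add_diff_inverse2)
  ultimately show ?thesis
    using B by simp
qed

lemma dim_sum_disjoint:
  assumes "subspace S" "subspace T" "S \<inter> T \<subseteq> {0}"
  shows "dim {x + y |x y. x \<in> S \<and> y \<in> T} = dim S + dim T"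
proof -
  have "dim (S \<inter> T) = 0"
    using assms(3) by simp
  then show ?thesis
    using dim_sums_Int[OF assms(1,2)] by linarith
qed

text \<open>A subspace of least dimension is minimal for inclusion. Applied to
  \<open>t\<close>-stable subspaces this replaces simultaneous diagonalization: a minimal one cannot
  be cut down further by eigenspaces of single elements of \<open>t\<close>.\<close>

lemma minimal_subspace:
  assumes "subspace U" "Q U"
  shows "\<exists>W. subspace W \<and> Q W \<and> (\<forall>V. subspace V \<longrightarrow> Q V \<longrightarrow> V \<subseteq> W \<longrightarrow> V = W)"
proof -
  let ?P = "\<lambda>n. \<exists>W. subspace W \<and> Q W \<and> dim W = n"
  have "?P (dim U)"
    using assms by blast
  then have "?P (LEAST n. ?P n)"
    by (rule LeastI)
  then obtain W where W: "subspace W" "Q W" "dim W = (LEAST n. ?P n)"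
    by blast
  have "V = W" if "subspace V" "Q V" "V \<subseteq> W" for V
  proof (rule subspace_dim_equal[OF that(1) W(1) that(3)])
    show "dim W \<le> dim V"
      unfolding W(3) by (rule Least_le) (use that in blast)
  qed
  then show ?thesis
    using W by blast
qed

lemma span_gen_eigenspaces: "lin f \<Longrightarrow> span (\<Union>a\<in>UNIV. gen_eigenspace f a) = UNIV"
  using gen_eigenspace_span[of f UNIV] by auto

lemma lin_eq_on_gen_eigenspaces:
  assumes f: "lin f" and FG: "lin F" "lin G" and eq: "\<And>a x. x \<in> gen_eigenspace f a \<Longrightarrow> F x = G x"
  shows "F x = G x"
proof -
  have "x \<in> span (\<Union>a\<in>UNIV. gen_eigenspace f a)"
    using span_gen_eigenspaces[OF f] by blast
  then show ?thesis
    by (rule endo.linear_eq_on[OF FG]) (use eq in auto)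
qed

section \<open>Additive Jordan decomposition and traces\<close>

definition semisimple_part :: "('g \<Rightarrow> 'g) \<Rightarrow> 'g \<Rightarrow> 'g" where
  "semisimple_part f = (SOME D. lin D \<and> (\<forall>a. \<forall>x\<in>gen_eigenspace f a. D x = a *s x))"

text \<open>Existence comes from the scaling operator of the generalized eigenspaces. As these span
  the space, the choice is in fact unique.\<close>

lemma semisimple_part:
  assumes "lin f"
  shows lin_semisimple_part: "lin (semisimple_part f)"
    and semisimple_part_eq: "x \<in> gen_eigenspace f a \<Longrightarrow> semisimple_part f x = a *s x"
proof -
  obtain D where "lin D" "\<And>i x. i \<in> UNIV \<Longrightarrow> x \<in> gen_eigenspace f i \<Longrightarrow> D x = i *s x"
    using scaling_operator[OF direct_family_gen_eigenspace[OF assms] span_gen_eigenspaces[OF assms],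
        of "\<lambda>a. a"] by blast
  then have "lin D \<and> (\<forall>a. \<forall>x\<in>gen_eigenspace f a. D x = a *s x)"
    by blast
  then have *: "lin (semisimple_part f) \<and> (\<forall>a. \<forall>x\<in>gen_eigenspace f a. semisimple_part f x = a *s x)"
    unfolding semisimple_part_def
    by (rule someI[of "\<lambda>D. lin D \<and> (\<forall>a. \<forall>x\<in>gen_eigenspace f a. D x = a *s x)"])
  then show "lin (semisimple_part f)"
    and "x \<in> gen_eigenspace f a \<Longrightarrow> semisimple_part f x = a *s x"
    by blast+
qed

lemma semisimple_part_commute:
  assumes f: "lin f" and g: "lin g" and c: "\<And>x. f (g x) = g (f x)"
  shows "semisimple_part f (g x) = g (semisimple_part f x)"
proof (rule lin_eq_on_gen_eigenspaces[OF f, where F = "\<lambda>x. semisimple_part f (g x)"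
      and G = "\<lambda>x. g (semisimple_part f x)"])
  show "lin (\<lambda>x. semisimple_part f (g x))" "lin (\<lambda>x. g (semisimple_part f x))"
    by (rule lin_compose[OF lin_semisimple_part[OF f] g] lin_compose[OF g lin_semisimple_part[OF f]])+
next
  fix a x assume x: "x \<in> gen_eigenspace f a"
  have "g x \<in> gen_eigenspace f a"
    by (rule gen_eigenspace_closed[OF g c x])
  then show "semisimple_part f (g x) = g (semisimple_part f x)"
    using x by (simp add: semisimple_part_eq[OF f] endo.linear_scale[OF g])
qed

text \<open>On the generalized eigenspace of \<open>a\<close> the difference is f - a, and the
  vectors killed by some power of a linear operator form a subspace.\<close>

lemma nilpotent_part:
  assumes f: "lin f"
  shows "\<exists>n. ((\<lambda>x. f x - semisimple_part f x) ^^ n) x = 0"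
proof -
  let ?N = "\<lambda>x. f x - semisimple_part f x"
  have N: "lin ?N"
    by (rule linI) (simp_all add: endo.linear_add[OF f] endo.linear_scale[OF f] scale_right_diff_distrib
        endo.linear_add[OF lin_semisimple_part[OF f]] endo.linear_scale[OF lin_semisimple_part[OF f]])
  have "\<exists>n. (?N ^^ n) x = 0" if "x \<in> gen_eigenspace f a" for a x
  proof -
    have "(?N ^^ n) x = (shift f a ^^ n) x \<and> (shift f a ^^ n) x \<in> gen_eigenspace f a" for n
    proof (induction n)
      case (Suc n)
      let ?y = "(shift f a ^^ n) x"
      have y: "?y \<in> gen_eigenspace f a"
        using Suc by blast
      then have "f ?y \<in> gen_eigenspace f a"
        by (intro gen_eigenspace_closed[OF f]) auto
      then have "shift f a ?y \<in> gen_eigenspace f a"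
        using y by (intro shift_in_subspace subspace_gen_eigenspace f)
      moreover have "?N ?y = shift f a ?y"
        using semisimple_part_eq[OF f y] by (simp add: shift_def)
      ultimately show ?case
        using Suc by simp
    qed (use that in simp)
    then show ?thesis
      using that by (auto simp: gen_eigenspace_def)
  qed
  then have "(\<Union>a\<in>UNIV. gen_eigenspace f a) \<subseteq> {x. \<exists>n. (?N ^^ n) x = 0}"
    by blast
  then have "span (\<Union>a\<in>UNIV. gen_eigenspace f a) \<subseteq> {x. \<exists>n. (?N ^^ n) x = 0}"
    by (rule span_minimal) (rule subspace_locally_nilpotent[OF N])
  then show ?thesis
    using span_gen_eigenspaces[OF f] by blast
qed

text \<open>The nilpotent part of \<open>f\<close> commutes with \<open>g\<close>, so its product
  with \<open>g\<close> is nilpotent and has trace 0.\<close>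

lemma trace_semisimple_part:
  assumes f: "lin f" and g: "lin g" and c: "\<And>x. f (g x) = g (f x)"
  shows "trace (\<lambda>x. f (g x)) = trace (\<lambda>x. semisimple_part f (g x))"
proof -
  let ?N = "\<lambda>x. f x - semisimple_part f x"
  have N: "lin ?N"
    by (rule linI) (simp_all add: endo.linear_add[OF f] endo.linear_scale[OF f] scale_right_diff_distrib
        endo.linear_add[OF lin_semisimple_part[OF f]] endo.linear_scale[OF lin_semisimple_part[OF f]])
  have cN: "?N (g x) = g (?N x)" for x
    using c semisimple_part_commute[OF f g c] by (simp add: endo.linear_diff[OF g])
  have "((\<lambda>x. ?N (g x)) ^^ n) x = (g ^^ n) ((?N ^^ n) x)" for n x
  proof (induction n)
    case (Suc n)
    have "?N (g ((g ^^ n) y)) = (g ^^ Suc n) (?N y)" for y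
      using funpow_commute[of g ?N "Suc n" y] cN by simp
    then show ?case
      using Suc by simp
  qed simp
  moreover obtain n where "\<And>x. (?N ^^ n x) x = 0"
    using nilpotent_part[OF f] by metis
  ultimately have "((\<lambda>x. ?N (g x)) ^^ n x) x = 0" for x
    by (simp only: endo.linear_0[OF lin_funpow[OF g]])
  then have "\<exists>n. ((\<lambda>x. ?N (g x)) ^^ n) x = 0" for x
    by blast
  then have "trace (\<lambda>x. ?N (g x)) = 0"
    by (intro trace_nilpotent lin_compose[OF N g])
  then show ?thesis
    by (simp add: trace_diff)
qed

text \<open>Taking traces in DF - FD = cF leaves 0 on the left.\<close>

lemma trace_weight_shift:
  assumes D: "lin D" and F: "lin F" and DF: "\<And>x. D (F x) = F (D x) + c *s F x" and "c \<noteq> 0"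
  shows "trace F = 0"
proof -
  have "trace (\<lambda>x. D (F x)) = trace (\<lambda>x. F (D x)) + c * trace F"
    using DF by (simp add: trace_add trace_scale)
  then show ?thesis
    using trace_commute[OF D F] \<open>c \<noteq> 0\<close> by simp
qed

text \<open>Replacing the two factors \<open>f\<close> one after the other by the semisimple part D
  preserves the trace, and the trace of D^2 is a sum of squares of integers, not all zero. In
  characteristic 0 this is nonzero.\<close>

lemma trace_square_nonzero:
  assumes f: "lin f" and int: "\<And>a. gen_eigenspace f a \<noteq> {0} \<Longrightarrow> a \<in> \<int>"
    and nz: "a \<noteq> 0" "gen_eigenspace f a \<noteq> {0}"
  shows "trace (\<lambda>x. f (f x)) \<noteq> 0"
proof -
  let ?D = "semisimple_part f"
  note D = lin_semisimple_part[OF f]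
  obtain C where C: "independent C" "finite C" "C \<subseteq> (\<Union>a\<in>UNIV. gen_eigenspace f a)" "span C = UNIV"
    using direct_family_basis[OF span_gen_eigenspaces[OF f]] .
  have "\<forall>b\<in>C. \<exists>k::int. b \<in> gen_eigenspace f (of_int k)"
  proof
    fix b assume b: "b \<in> C"
    then obtain a where a: "b \<in> gen_eigenspace f a"
      using C(3) by blast
    moreover have "b \<noteq> 0"
      using C(1) b dependent_zero by blast
    ultimately have "a \<in> \<int>"
      using int by blast
    then show "\<exists>k::int. b \<in> gen_eigenspace f (of_int k)"
      using a by (auto elim: Ints_cases)
  qed
  then obtain d :: "'g \<Rightarrow> int" where d: "\<And>b. b \<in> C \<Longrightarrow> b \<in> gen_eigenspace f (of_int (d b))"
    by metis
  have Db: "?D b = of_int (d b) *s b" if "b \<in> C" for b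
    using semisimple_part_eq[OF f d[OF that]] .
  have cf: "f (?D x) = ?D (f x)" for x
    using semisimple_part_commute[OF f f] by simp
  have "trace (\<lambda>x. f (f x)) = trace (\<lambda>x. ?D (f x))"
    by (rule trace_semisimple_part[OF f f]) simp
  also have "\<dots> = trace (\<lambda>x. f (?D x))"
    by (simp add: cf)
  also have "\<dots> = trace (\<lambda>x. ?D (?D x))"
    by (rule trace_semisimple_part[OF f D cf])
  also have "\<dots> = (\<Sum>b\<in>C. representation C (?D (?D b)) b)"
    by (rule trace_eq[OF lin_compose[OF D D] C(1,4)])
  also have "\<dots> = (\<Sum>b\<in>C. of_int (d b * d b))"
    using C by (intro sum.cong)
      (simp_all add: Db endo.linear_scale[OF D] representation_scale representation_basis)
  also have "\<dots> = of_int (\<Sum>b\<in>C. d b * d b)"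
    by simp
  finally have tr: "trace (\<lambda>x. f (f x)) = of_int (\<Sum>b\<in>C. d b * d b)" .
  have "\<exists>b\<in>C. d b \<noteq> 0"
  proof (rule ccontr)
    assume none: "\<not> (\<exists>b\<in>C. d b \<noteq> 0)"
    have "?D x = 0" for x
    proof (rule endo.linear_eq_on[OF D, of "\<lambda>_. 0" x C])
      show "lin (\<lambda>_. 0)"
        by (rule linI) simp_all
      show "x \<in> span C"
        using C(4) by simp
      show "?D b = 0" if "b \<in> C" for b
        using Db[OF that] none that by simp
    qed
    moreover obtain x where "x \<in> gen_eigenspace f a" "x \<noteq> 0"
      using nz(2) subspace_0[OF subspace_gen_eigenspace[OF f]] by blast
    ultimately show False
      using semisimple_part_eq[OF f, of x a] nz(1) by simp
  qed
  then have "(\<Sum>b\<in>C. d b * d b) \<noteq> 0"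
    using C(2) by (simp add: sum_nonneg_eq_0_iff)
  then show ?thesis
    unfolding tr by (simp only: of_int_eq_0_iff simp_thms)
qed

end

section \<open>The Cartan subalgebra and the Killing form\<close>

locale cartan_setting = simple_lie_algebra scale br + endo_space scale Basis
  for scale :: "'k::{alg_closed_field, field_char_0} \<Rightarrow> 'g::ab_group_add \<Rightarrow> 'g" (infixr "*s" 75)
    and br :: "'g \<Rightarrow> 'g \<Rightarrow> 'g" and Basis :: "'g set" +
  fixes t :: "'g set" and l :: nat and \<alpha> :: "nat \<Rightarrow> 'g \<Rightarrow> 'k"
  assumes cartan: "cartan_subalgebra t" and simple_roots: "simple_roots t l \<alpha>"
begin

abbreviation zero_form :: "'g \<Rightarrow> 'k" where
  "zero_form \<equiv> \<lambda>_. 0"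

text \<open>The zero form is included so that \<open>t\<close> is one of the summands of the
  decomposition.\<close>

definition weights :: "('g \<Rightarrow> 'k) set" where
  "weights = insert zero_form (roots t)"

lemma lin_br: "lin (br x)"
  by (rule linI) (simp_all add: br_add_right br_scale_right)

lemmas br_simps =
  br_add_right br_scale_right br_add_left br_scale_left endo.linear_0[OF lin_br]
  endo.linear_diff[OF lin_br] endo.linear_neg[OF lin_br]

lemma br_zero_left [simp]: "br 0 x = 0"
  using br_add_left[of 0 0 x] by simp

lemma br_zero_right [simp]: "br x 0 = 0"
  using br_add_right[of x 0 0] by simp

lemma br_anti: "br x y = - br y x"
proof -
  have "br x y + br y x = br (x + y) (x + y) - br x x - br y y"
    by (simp add: br_add_left br_add_right)
  then have "br x y + br y x = 0"
    by (simp add: br_self)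
  then show ?thesis
    by (simp add: eq_neg_iff_add_eq_0)
qed

lemma br_diff_left: "br (x - y) z = br x z - br y z"
  using br_anti[of "x - y" z] br_anti[of x z] br_anti[of y z]
  by (simp add: endo.linear_diff[OF lin_br])

lemma br_derivation: "br x (br y z) = br (br x y) z + br y (br x z)"
proof -
  have "br x (br y z) + br y (br z x) + br z (br x y) = 0"
    by (rule jacobi)
  moreover have "br y (br z x) = - br y (br x z)"
    using br_anti[of z x] by (simp add: endo.linear_neg[OF lin_br])
  moreover have "br z (br x y) = - br (br x y) z"
    by (rule br_anti)
  ultimately show ?thesis
    by (simp add: algebra_simps)
qed

lemma subspace_t: "subspace t"
  using cartan by (simp add: cartan_subalgebra_def subalgebra_def)

lemma br_in_t: "x \<in> t \<Longrightarrow> y \<in> t \<Longrightarrow> br x y \<in> t"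
  using cartan by (simp add: cartan_subalgebra_def subalgebra_def)

lemma normalizer_t: "normalizer t = t"
  using cartan by (simp add: cartan_subalgebra_def)

lemma alpha_root: "i \<in> {1..l} \<Longrightarrow> \<alpha> i \<in> roots t"
  using simple_roots by (simp add: simple_roots_def)

lemma simple_roots_independent:
  "(\<And>h. h \<in> t \<Longrightarrow> (\<Sum>i=1..l. c i * \<alpha> i h) = 0) \<Longrightarrow> i \<in> {1..l} \<Longrightarrow> c i = 0"
  using simple_roots[unfolded simple_roots_def, THEN conjunct2, THEN conjunct1, rule_format, of c i]
  by simp

lemma simple_roots_span:
  "f \<in> dual_space t \<Longrightarrow> \<exists>c. \<forall>h\<in>t. f h = (\<Sum>i=1..l. c i * \<alpha> i h)"
  using simple_roots by (simp add: simple_roots_def)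

lemma root_dual: "\<gamma> \<in> roots t \<Longrightarrow> \<gamma> \<in> dual_space t"
  by (simp add: roots_def)

lemma zero_form_dual: "zero_form \<in> dual_space t"
  by (simp add: dual_space_def)

lemma weight_dual: "\<gamma> \<in> weights \<Longrightarrow> \<gamma> \<in> dual_space t"
  using root_dual zero_form_dual by (auto simp: weights_def)

lemma dual_add: "\<gamma> \<in> dual_space t \<Longrightarrow> x \<in> t \<Longrightarrow> y \<in> t \<Longrightarrow> \<gamma> (x + y) = \<gamma> x + \<gamma> y"
  and dual_scale: "\<gamma> \<in> dual_space t \<Longrightarrow> x \<in> t \<Longrightarrow> \<gamma> (c *s x) = c * \<gamma> x"
  and dual_outside: "\<gamma> \<in> dual_space t \<Longrightarrow> x \<notin> t \<Longrightarrow> \<gamma> x = 0"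
  by (simp_all add: dual_space_def)

lemma dual_zero: "\<gamma> \<in> dual_space t \<Longrightarrow> \<gamma> 0 = 0"
  using dual_scale[of \<gamma> 0 0] subspace_0[OF subspace_t] by simp

lemma dual_diff: "\<gamma> \<in> dual_space t \<Longrightarrow> x \<in> t \<Longrightarrow> y \<in> t \<Longrightarrow> \<gamma> (x - y) = \<gamma> x - \<gamma> y"
  using dual_add[of \<gamma> "x - y" y] subspace_diff[OF subspace_t] by simp

lemma dual_sum: "\<gamma> \<in> dual_space t \<Longrightarrow> (\<And>i. i \<in> I \<Longrightarrow> x i \<in> t) \<Longrightarrow> \<gamma> (\<Sum>i\<in>I. x i) = (\<Sum>i\<in>I. \<gamma> (x i))"
proof (induction I rule: infinite_finite_induct)
  case (insert i I)
  then show ?case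
    using dual_add[of \<gamma> "x i" "sum x I"] subspace_sum[OF subspace_t, of I x] by simp
qed (simp_all add: dual_zero)

lemma dual_eqI: "\<gamma> \<in> dual_space t \<Longrightarrow> \<beta> \<in> dual_space t \<Longrightarrow> (\<And>h. h \<in> t \<Longrightarrow> \<gamma> h = \<beta> h) \<Longrightarrow> \<gamma> = \<beta>"
  by (rule ext) (metis dual_outside)

text \<open>If \<open>x\<close> were nonzero, the coordinate along \<open>x\<close> in some basis,
  cut off outside \<open>t\<close>, would be a linear form on \<open>t\<close> with value 1 at
  \<open>x\<close>; but every form is a combination of the simple roots.\<close>

lemma simple_roots_separate:
  assumes x: "x \<in> t" and "\<And>i. i \<in> {1..l} \<Longrightarrow> \<alpha> i x = 0"
  shows "x = 0"
proof (rule ccontr)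
  assume "x \<noteq> 0"
  then have i: "independent {x}"
    by simp
  let ?B = "extend_basis {x}"
  have B: "independent ?B" "span ?B = UNIV" "x \<in> ?B"
    using independent_extend_basis[OF i] span_extend_basis[OF i] extend_basis_superset[OF i] by auto
  let ?f = "\<lambda>z. if z \<in> t then representation ?B z x else 0"
  have "?f \<in> dual_space t"
    using subspace_t B by (simp add: dual_space_def representation_add representation_scale
        subspace_add subspace_scale)
  then obtain c where "\<forall>h\<in>t. ?f h = (\<Sum>i=1..l. c i * \<alpha> i h)"
    using simple_roots_span[of ?f] by blast
  then have "?f x = 0"
    using assms by simp
  moreover have "?f x = 1"
    using x B by (simp add: representation_basis)
  ultimately show False
    by simp
qed

text \<open>Brackets of elements of \<open>t\<close> act by zero on every simple root vector, and the simple roots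
  span the dual of \<open>t\<close>.\<close>
lemma t_abelian:
  assumes "x \<in> t" "y \<in> t"
  shows "br x y = 0"
proof (rule simple_roots_separate)
  show "br x y \<in> t"
    using assms by (rule br_in_t)
next
  fix i assume "i \<in> {1..l}"
  then have r: "\<alpha> i \<in> roots t"
    by (rule alpha_root)
  have "0 \<in> root_space t (\<alpha> i)"
    by (simp add: root_space_def)
  then obtain v where v: "v \<in> root_space t (\<alpha> i)" "v \<noteq> 0"
    using r unfolding roots_def by blast
  have e: "br h v = \<alpha> i h *s v" if "h \<in> t" for h
    using v(1) that by (simp add: root_space_def)
  have "br (br x y) v = br x (br y v) - br y (br x v)"
    using br_derivation[of x y v] by simp
  also have "\<dots> = 0"
    using assms e by (simp add: br_scale_right mult.commute)
  finally have "\<alpha> i (br x y) *s v = 0"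
    using e[OF br_in_t[OF assms]] by simp
  then show "\<alpha> i (br x y) = 0"
    using v(2) by simp
qed

text \<open>Linear independence of forms is turned into surjectivity of evaluation, by induction on
  the set of indices where values are prescribed.\<close>

lemma prescribed_values: "\<exists>y\<in>t. \<forall>i\<in>{1..l}. \<alpha> i y = a i"
proof -
  have "\<exists>y\<in>t. \<forall>i\<in>I. \<alpha> i y = a i" if "I \<subseteq> {1..l}" for I and a :: "nat \<Rightarrow> 'k"
  proof -
    have "finite I"
      using that finite_subset by blast
    then show ?thesis
      using that
    proof (induction I arbitrary: a)
      case empty
      then show ?case
        using subspace_0[OF subspace_t] by auto
    next
      case (insert j I)
      have d: "\<alpha> i \<in> dual_space t" if "i \<in> insert j I" for i
        using insert.prems that alpha_root root_dual by blast
      have "\<exists>y\<in>t. \<forall>k\<in>I. \<alpha> k y = (if k = i then 1 else 0)" for i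
        using insert.IH[of "\<lambda>k. if k = i then 1 else 0"] insert.prems by blast
      then obtain Y where Y: "\<And>i. Y i \<in> t" "\<And>i k. k \<in> I \<Longrightarrow> \<alpha> k (Y i) = (if k = i then 1 else 0)"
        by metis
      \<comment> \<open>This is \<alpha>_j corrected so as to vanish on all \<open>Y i\<close>. It
        is a nontrivial combination of independent forms, so it is nonzero at some
        \<open>h\<close>.\<close>
      let ?c = "\<lambda>i. if i = j then 1 else if i \<in> I then - \<alpha> j (Y i) else 0"
      have "\<exists>h\<in>t. (\<Sum>i=1..l. ?c i * \<alpha> i h) \<noteq> 0"
      proof (rule ccontr)
        assume none: "\<not> (\<exists>h\<in>t. (\<Sum>i=1..l. ?c i * \<alpha> i h) \<noteq> 0)"
        have "?c j = 0"
          by (rule simple_roots_independent[of ?c j]) (use none insert.prems in blast)+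
        then show False
          by simp
      qed
      then obtain h where h: "h \<in> t" "(\<Sum>i=1..l. ?c i * \<alpha> i h) \<noteq> 0"
        by blast
      have "(\<Sum>i=1..l. ?c i * \<alpha> i h) = (\<Sum>i\<in>insert j I. ?c i * \<alpha> i h)"
        using insert.prems by (intro sum.mono_neutral_right) auto
      also have "\<dots> = \<alpha> j h + (\<Sum>i\<in>I. - \<alpha> j (Y i) * \<alpha> i h)"
        using insert.hyps by (simp add: sum.insert) (rule sum.cong, auto)
      also have "\<dots> = \<alpha> j h - (\<Sum>i\<in>I. \<alpha> i h * \<alpha> j (Y i))"
        by (simp add: sum_negf mult.commute)
      finally have ne: "\<alpha> j h - (\<Sum>i\<in>I. \<alpha> i h * \<alpha> j (Y i)) \<noteq> 0"
        using h by simp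
      have comb: "(\<Sum>i\<in>I. b i *s Y i) \<in> t" for b
        by (intro subspace_sum subspace_scale subspace_t Y)
      have val: "\<alpha> k (\<Sum>i\<in>I. b i *s Y i) = (\<Sum>i\<in>I. b i * \<alpha> k (Y i))" if "k \<in> insert j I" for k b
      proof -
        have "\<alpha> k (\<Sum>i\<in>I. b i *s Y i) = (\<Sum>i\<in>I. \<alpha> k (b i *s Y i))"
          by (intro dual_sum d that subspace_scale subspace_t Y)
        then show ?thesis
          by (simp add: dual_scale[OF d[OF that] Y(1)])
      qed
      have valI: "\<alpha> k (\<Sum>i\<in>I. b i *s Y i) = b k" if "k \<in> I" for k b
        using val[of k b] that Y(2)[OF that] insert.hyps(1) by (simp add: sum.delta if_distrib cong: if_cong)
      \<comment> \<open>The projection of \<open>h\<close> along the dual vectors is killed by the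
        forms from \<open>I\<close>, while \<alpha>_j takes on it the nonzero value just found; it
        adjusts the value at \<open>j\<close> alone.\<close>
      define w where "w = h - (\<Sum>i\<in>I. \<alpha> i h *s Y i)"
      have w: "w \<in> t" "\<And>k. k \<in> I \<Longrightarrow> \<alpha> k w = 0" "\<alpha> j w \<noteq> 0"
        unfolding w_def using h(1) comb ne d valI val[of j]
        by (auto simp: dual_diff subspace_diff[OF subspace_t])
      define z where "z = (\<Sum>i\<in>I. a i *s Y i)"
      have z: "z \<in> t" "\<And>k. k \<in> I \<Longrightarrow> \<alpha> k z = a k"
        unfolding z_def using comb valI by auto
      let ?y = "z + ((a j - \<alpha> j z) / \<alpha> j w) *s w"
      have "?y \<in> t"
        using z w by (intro subspace_add subspace_scale subspace_t)
      moreover have "\<alpha> k ?y = a k" if "k \<in> insert j I" for k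
        using that w z d[OF that] subspace_scale[OF subspace_t] by (auto simp: dual_add dual_scale)
      ultimately show ?case
        by blast
    qed
  qed
  then show ?thesis
    by blast
qed

lemma root_combination:
  assumes "\<gamma> \<in> roots t"
  shows "\<exists>c :: nat \<Rightarrow> int. (\<forall>h\<in>t. \<gamma> h = (\<Sum>i=1..l. of_int (c i) * \<alpha> i h)) \<and>
    ((\<forall>i\<in>{1..l}. c i \<ge> 0) \<or> (\<forall>i\<in>{1..l}. c i \<le> 0)) \<and> (\<exists>i\<in>{1..l}. c i \<noteq> 0)"
proof -
  from simple_roots[unfolded simple_roots_def, THEN conjunct2, THEN conjunct2, THEN conjunct2, THEN bspec, OF assms]
  obtain c :: "nat \<Rightarrow> int" where "(\<forall>h\<in>t. \<gamma> h = (\<Sum>i=1..l. of_int (c i) * \<alpha> i h)) \<and>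
    ((\<forall>i\<in>{1..l}. c i \<ge> 0) \<or> (\<forall>i\<in>{1..l}. c i \<le> 0))" ..
  then have c: "\<forall>h\<in>t. \<gamma> h = (\<Sum>i=1..l. of_int (c i) * \<alpha> i h)"
    "(\<forall>i\<in>{1..l}. c i \<ge> 0) \<or> (\<forall>i\<in>{1..l}. c i \<le> 0)"
    by (rule conjunct1, rule conjunct2)
  have "\<exists>i\<in>{1..l}. c i \<noteq> 0"
  proof (rule ccontr)
    assume "\<not> (\<exists>i\<in>{1..l}. c i \<noteq> 0)"
    then have "\<gamma> h = 0" if "h \<in> t" for h
      using c(1) that by simp
    then have "\<gamma> = zero_form"
      using dual_eqI[OF root_dual[OF assms] zero_form_dual] by blast
    then show False
      using assms by (simp add: roots_def)
  qed
  then show ?thesis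
    using c by (intro exI[of _ c] conjI)
qed

section \<open>Weight vectors in \<open>t\<close>-stable subspaces\<close>

lemma subspace_root_space: "subspace (root_space t \<gamma>)"
  by (rule subspaceI) (auto simp: root_space_def br_simps scale_right_distrib scale_left_commute)

lemma t_le_root_space_zero: "t \<subseteq> root_space t zero_form"
  using t_abelian by (auto simp: root_space_def)

text \<open>The scalar by which \<open>h\<close> acts can be read off on one nonzero vector of
  \<open>U\<close>, which makes it linear in \<open>h\<close>.\<close>

lemma common_weight:
  assumes U: "subspace U" "U \<noteq> {0}" and "\<And>h. h \<in> t \<Longrightarrow> \<exists>a. \<forall>x\<in>U. br h x = a *s x"
  shows "\<exists>\<gamma>\<in>weights. U \<subseteq> root_space t \<gamma>"
proof -
  obtain c where c: "\<And>h x. h \<in> t \<Longrightarrow> x \<in> U \<Longrightarrow> br h x = c h *s x"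
    using assms(3) by metis
  obtain u where u: "u \<in> U" "u \<noteq> 0"
    using U subspace_0[OF U(1)] by blast
  define \<gamma> where "\<gamma> = (\<lambda>h. if h \<in> t then c h else 0)"
  have "c (x + y) = c x + c y" if "x \<in> t" "y \<in> t" for x y
  proof -
    have "c (x + y) *s u = (c x + c y) *s u"
      using c[OF _ u(1)] that subspace_add[OF subspace_t] by (simp add: br_add_left scale_left_distrib flip: c[OF _ u(1)])
    then show ?thesis
      using u(2) by simp
  qed
  moreover have "c (a *s x) = a * c x" if "x \<in> t" for a x
  proof -
    have "c (a *s x) *s u = (a * c x) *s u"
      using c[OF _ u(1), of "a *s x"] c[OF that u(1)] that subspace_scale[OF subspace_t]
      by (auto simp: br_scale_left)
    then show ?thesis
      using u(2) scale_right_imp_eq by blast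
  qed
  ultimately have d: "\<gamma> \<in> dual_space t"
    using subspace_add[OF subspace_t] subspace_scale[OF subspace_t] by (simp add: dual_space_def \<gamma>_def)
  have le: "U \<subseteq> root_space t \<gamma>"
    using c by (auto simp: root_space_def \<gamma>_def)
  then have "root_space t \<gamma> \<noteq> {0}"
    using u by blast
  then have "\<gamma> \<in> weights"
    using d by (auto simp: weights_def roots_def)
  then show ?thesis
    using le by blast
qed

text \<open>In a minimal nonzero \<open>t\<close>-stable subspace every eigenspace of an element of
  \<open>t\<close> is again \<open>t\<close>-stable, because \<open>t\<close> is abelian. Hence each
  element acts there by a scalar.\<close>

lemma common_eigenvector:
  assumes U: "subspace U" "U \<noteq> {0}" "\<And>h x. h \<in> t \<Longrightarrow> x \<in> U \<Longrightarrow> br h x \<in> U"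
  shows "\<exists>\<gamma>\<in>weights. \<exists>x\<in>U. x \<noteq> 0 \<and> x \<in> root_space t \<gamma>"
proof -
  let ?Q = "\<lambda>W. W \<noteq> {0} \<and> W \<subseteq> U \<and> (\<forall>h\<in>t. \<forall>x\<in>W. br h x \<in> W)"
  have "?Q U"
    using U by blast
  from minimal_subspace[of U ?Q, OF U(1) this] obtain W where W: "subspace W" "?Q W"
    and min: "\<forall>V. subspace V \<longrightarrow> ?Q V \<longrightarrow> V \<subseteq> W \<longrightarrow> V = W"
    by blast
  have "\<exists>a. \<forall>x\<in>W. br h x = a *s x" if h: "h \<in> t" for h
  proof -
    obtain x where "x \<in> W" "x \<noteq> 0"
      using W subspace_0 by blast
    then obtain a y where y: "y \<in> W" "y \<noteq> 0" "shift (br h) a y = 0"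
      using eigenvector_modulo_subspace[OF lin_br[of h] subspace_single_0, of W x] W h by auto
    let ?V = "{x\<in>W. shift (br h) a x = 0}"
    have "?V = W \<inter> {x. shift (br h) a x = 0}"
      by auto
    then have "subspace ?V"
      using W endo.linear_subspace_kernel[OF lin_shift[OF lin_br]] by (auto intro: subspace_inter)
    moreover have "shift (br h) a (br h' x) = br h' (shift (br h) a x)" if "h' \<in> t" for h' x
      using br_derivation[of h h' x] t_abelian[OF h that] by (simp add: shift_def br_simps)
    then have "br h' x \<in> ?V" if "h' \<in> t" "x \<in> ?V" for h' x
      using that W by simp
    moreover have "?V \<noteq> {0}"
      using y by auto
    ultimately have "?V = W"
      using min[rule_format, of ?V] W by blast
    then show ?thesis
      by (intro exI[of _ a]) (auto simp: shift_def)
  qed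
  then obtain \<gamma> where "\<gamma> \<in> weights" "W \<subseteq> root_space t \<gamma>"
    using common_weight[of W] W by blast
  moreover obtain x where "x \<in> W" "x \<noteq> 0"
    using W subspace_0 by blast
  ultimately show ?thesis
    using W by blast
qed

text \<open>These are the strictly dominant integral coweights: integers as eigenvalues make the
  trace argument work, and positivity keeps every root away from 0.\<close>

definition special :: "'g \<Rightarrow> bool" where
  "special h \<longleftrightarrow> h \<in> t \<and> (\<forall>i\<in>{1..l}. \<exists>n::nat. n > 0 \<and> \<alpha> i h = of_nat n)"

text \<open>The coefficients of a root share one sign, so the positive values at the simple roots
  cannot cancel.\<close>

lemma special_root_value:
  assumes h: "special h" and "\<gamma> \<in> roots t"
  shows "\<exists>k::int. k \<noteq> 0 \<and> \<gamma> h = of_int k"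
proof -
  obtain c :: "nat \<Rightarrow> int" where c: "\<forall>h\<in>t. \<gamma> h = (\<Sum>i=1..l. of_int (c i) * \<alpha> i h)"
    "(\<forall>i\<in>{1..l}. c i \<ge> 0) \<or> (\<forall>i\<in>{1..l}. c i \<le> 0)" "\<exists>i\<in>{1..l}. c i \<noteq> 0"
    using root_combination[OF assms(2)] by meson
  obtain n :: "nat \<Rightarrow> nat" where n: "\<And>i. i \<in> {1..l} \<Longrightarrow> n i > 0 \<and> \<alpha> i h = of_nat (n i)"
    using h unfolding special_def by metis
  let ?k = "\<Sum>i=1..l. c i * int (n i)"
  have "\<gamma> h = of_int ?k"
    using c(1) h n by (simp add: special_def)
  moreover have "?k \<noteq> 0"
  proof
    assume k0: "?k = 0"
    have "\<forall>i\<in>{1..l}. c i * int (n i) = 0"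
      using c(2)
    proof
      assume "\<forall>i\<in>{1..l}. c i \<ge> 0"
      then show ?thesis
        using k0 sum_nonneg_eq_0_iff[of "{1..l}" "\<lambda>i. c i * int (n i)"] by auto
    next
      assume "\<forall>i\<in>{1..l}. c i \<le> 0"
      then show ?thesis
        using k0 sum_nonneg_eq_0_iff[of "{1..l}" "\<lambda>i. - (c i * int (n i))"]
        by (auto simp: mult_nonpos_nonneg sum_negf)
    qed
    then show False
      using c(3) n by fastforce
  qed
  ultimately show ?thesis
    by blast
qed

lemma ad_t_commute: "h \<in> t \<Longrightarrow> h' \<in> t \<Longrightarrow> br h (br h' x) = br h' (br h x)"
  using br_derivation[of h h' x] t_abelian[of h h'] by simp

lemma gen_eigenspace_ad_stable:
  "h \<in> t \<Longrightarrow> h' \<in> t \<Longrightarrow> x \<in> gen_eigenspace (br h) a \<Longrightarrow> br h' x \<in> gen_eigenspace (br h) a"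
  by (rule gen_eigenspace_closed[OF lin_br]) (rule ad_t_commute)

lemma gen_eigenspace_weight:
  assumes h: "h \<in> t" and U: "subspace U" "\<And>h x. h \<in> t \<Longrightarrow> x \<in> U \<Longrightarrow> br h x \<in> U"
    and ne: "gen_eigenspace (br h) a \<inter> U \<noteq> {0}"
  shows "\<exists>\<gamma>\<in>weights. \<exists>x\<in>U. x \<noteq> 0 \<and> x \<in> root_space t \<gamma> \<and> \<gamma> h = a"
proof -
  have "subspace (gen_eigenspace (br h) a \<inter> U)"
    by (intro subspace_inter subspace_gen_eigenspace lin_br U(1))
  moreover have "br h' x \<in> gen_eigenspace (br h) a \<inter> U" if "h' \<in> t" "x \<in> gen_eigenspace (br h) a \<inter> U" for h' x
    using that gen_eigenspace_ad_stable[OF h] U by blast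
  ultimately obtain \<gamma> x where *: "\<gamma> \<in> weights" "x \<in> gen_eigenspace (br h) a \<inter> U" "x \<noteq> 0" "x \<in> root_space t \<gamma>"
    using common_eigenvector[OF _ ne] by blast
  then have "br h x = \<gamma> h *s x"
    using h by (simp add: root_space_def)
  then have "x \<in> gen_eigenspace (br h) (\<gamma> h)"
    by (rule eigenvector_in_gen_eigenspace)
  then have "\<gamma> h = a"
    using gen_eigenspace_disjoint[OF lin_br] * by blast
  then show ?thesis
    using * by blast
qed

lemma special_eigenvalue_int:
  assumes h: "special h" and ne: "gen_eigenspace (br h) a \<noteq> {0}"
  shows "a \<in> \<int>"
proof -
  have "h \<in> t"
    using h by (simp add: special_def)
  then obtain \<gamma> where "\<gamma> \<in> weights" "\<gamma> h = a"
    using gen_eigenspace_weight[of h UNIV a] ne by auto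
  then show ?thesis
    using special_root_value[OF h, of \<gamma>] by (auto simp: weights_def)
qed

text \<open>If the null space were larger than \<open>t\<close>, a minimal \<open>t\<close>-stable
  subspace strictly above \<open>t\<close> inside it would be mapped into \<open>t\<close> by all
  elements of \<open>t\<close>. It would then normalize \<open>t\<close>, contrary to
  self-normalization.\<close>

lemma special_null_space:
  assumes h: "special h"
  shows "gen_eigenspace (br h) 0 = t"
proof (rule ccontr)
  let ?G = "gen_eigenspace (br h) 0"
  assume "?G \<noteq> t"
  have ht: "h \<in> t"
    using h by (simp add: special_def)
  have tG: "t \<subseteq> ?G"
    using t_abelian[OF ht] eigenvector_in_gen_eigenspace[of "br h" _ 0] by auto
  let ?Q = "\<lambda>W. t \<subseteq> W \<and> W \<noteq> t \<and> W \<subseteq> ?G \<and> (\<forall>h\<in>t. \<forall>x\<in>W. br h x \<in> W)"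
  have "?Q ?G"
    using tG \<open>?G \<noteq> t\<close> gen_eigenspace_ad_stable[OF ht] by auto
  from minimal_subspace[of ?G ?Q, OF subspace_gen_eigenspace[OF lin_br] this]
  obtain W where "subspace W \<and> ?Q W \<and> (\<forall>V. subspace V \<longrightarrow> ?Q V \<longrightarrow> V \<subseteq> W \<longrightarrow> V = W)" ..
  then have W: "subspace W" "?Q W"
    and min: "\<forall>V. subspace V \<longrightarrow> ?Q V \<longrightarrow> V \<subseteq> W \<longrightarrow> V = W"
    by (rule conjunct1, rule conjunct2[THEN conjunct1], rule conjunct2[THEN conjunct2])
  obtain x where x: "x \<in> W" "x \<notin> t"
    using W by blast
  have "br k y \<in> t" if k: "k \<in> t" and y: "y \<in> W" for k y
  proof -
    obtain a v where v: "v \<in> W" "v \<notin> t" "shift (br k) a v \<in> t"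
      using eigenvector_modulo_subspace[OF lin_br[of k] subspace_t _ _ x] W k by blast
    let ?V = "{x\<in>W. shift (br k) a x \<in> t}"
    have "?V = W \<inter> {x. shift (br k) a x \<in> t}"
      by auto
    then have "subspace ?V"
      using W endo.linear_subspace_linear_preimage[OF lin_shift[OF lin_br] subspace_t]
      by (auto intro: subspace_inter)
    moreover have cs: "shift (br k) a (br h' x) = br h' (shift (br k) a x)" if "h' \<in> t" for h' x
      using ad_t_commute[OF k that] by (simp add: shift_def br_simps)
    have "br h' x \<in> ?V" if "h' \<in> t" "x \<in> ?V" for h' x
      using that W cs t_abelian subspace_0[OF subspace_t] by auto
    moreover have "t \<subseteq> ?V"
      using W k t_abelian[OF k] by (auto intro!: shift_in_subspace subspace_t br_in_t)
    moreover have "?V \<noteq> t"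
      using v by blast
    ultimately have VW: "?V = W"
      using min[rule_format, of ?V] W by blast
    have "a = 0"
    proof (rule ccontr)
      assume a: "a \<noteq> 0"
      let ?s = "shift (br k) a v"
      \<comment> \<open>As \<open>br k ?s\<close> vanishes, this correction turns the eigenvector
        modulo \<open>t\<close> into a genuine one. The weight it produces is nonzero at
        \<open>k\<close> but 0 at the special \<open>h\<close>, which is impossible.\<close>
      let ?z = "v + inverse a *s ?s"
      have "?z \<in> W"
        using W v by (auto intro!: subspace_add subspace_scale)
      moreover have "?z \<noteq> 0"
      proof
        assume "?z = 0"
        then have "v = - (inverse a *s ?s)"
          by (simp add: eq_neg_iff_add_eq_0)
        then show False
          using v(2,3) subspace_neg[OF subspace_t] subspace_scale[OF subspace_t] by metis
      qed
      moreover have "br k ?z = a *s ?z"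
        using a t_abelian[OF k v(3)] by (simp add: br_simps scale_right_distrib shift_def)
      then have "?z \<in> gen_eigenspace (br k) a"
        by (rule eigenvector_in_gen_eigenspace)
      ultimately have "gen_eigenspace (br k) a \<inter> W \<noteq> {0}"
        by blast
      then obtain \<gamma> u where g: "\<gamma> \<in> weights" "u \<in> W" "u \<noteq> 0" "u \<in> root_space t \<gamma>" "\<gamma> k = a"
        using gen_eigenspace_weight[OF k, of W a] W by blast
      have "u \<in> gen_eigenspace (br h) (\<gamma> h)"
        using g(4) ht by (auto simp: root_space_def intro: eigenvector_in_gen_eigenspace)
      then have "\<gamma> h = 0"
        using gen_eigenspace_disjoint[OF lin_br] g(2,3) W by blast
      then have "\<gamma> = zero_form"
        using special_root_value[OF h, of \<gamma>] g(1) by (auto simp: weights_def)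
      then show False
        using g(5) a by simp
    qed
    then show ?thesis
      using VW y by (auto simp: shift_def)
  qed
  then have "\<forall>k\<in>t. br x k \<in> t"
    using x(1) br_anti subspace_neg[OF subspace_t] by metis
  then have "x \<in> normalizer t"
    by (simp add: normalizer_def)
  then show False
    using x(2) normalizer_t by simp
qed

text \<open>By the derivation rule \<open>shift (br h) (a + b)\<close> sends \<open>br x y\<close>
  to a sum of two brackets, each with one factor killed one step earlier; hence the induction on
  \<open>n + m\<close>.\<close>

lemma br_gen_eigenspace:
  assumes "x \<in> gen_eigenspace (br h) a" "y \<in> gen_eigenspace (br h) b"
  shows "br x y \<in> gen_eigenspace (br h) (a + b)"
proof -
  have "br x y \<in> gen_eigenspace (br h) (a + b)"
    if "(shift (br h) a ^^ n) x = 0" "(shift (br h) b ^^ m) y = 0" for n m x y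
    using that
  proof (induction "n + m" arbitrary: n m x y rule: less_induct)
    case less
    have sub: "subspace (gen_eigenspace (br h) (a + b))"
      by (rule subspace_gen_eigenspace[OF lin_br])
    show ?case
    proof (cases n)
      case 0
      then show ?thesis
        using less.prems subspace_0[OF sub] by simp
    next
      case n: (Suc n')
      show ?thesis
      proof (cases m)
        case 0
        then show ?thesis
          using less.prems subspace_0[OF sub] by simp
      next
        case m: (Suc m')
        have "br (shift (br h) a x) y \<in> gen_eigenspace (br h) (a + b)"
          using less.prems n by (intro less.hyps[of n' m]) (simp_all add: funpow_swap1)
        moreover have "br x (shift (br h) b y) \<in> gen_eigenspace (br h) (a + b)"
          using less.prems m by (intro less.hyps[of n m']) (simp_all add: funpow_swap1)
        ultimately have "br (shift (br h) a x) y + br x (shift (br h) b y) \<in> gen_eigenspace (br h) (a + b)"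
          by (rule subspace_add[OF sub])
        moreover have "br (shift (br h) a x) y + br x (shift (br h) b y) = shift (br h) (a + b) (br x y)"
          using br_derivation[of h x y]
          by (simp add: shift_def br_simps br_diff_left scale_left_distrib)
        ultimately obtain k where "(shift (br h) (a + b) ^^ k) (shift (br h) (a + b) (br x y)) = 0"
          by (auto simp: gen_eigenspace_def)
        then have "(shift (br h) (a + b) ^^ Suc k) (br x y) = 0"
          by (simp add: funpow_swap1)
        then show ?thesis
          unfolding gen_eigenspace_def by blast
      qed
    qed
  qed
  then show ?thesis
    using assms by (auto simp: gen_eigenspace_def)
qed

section \<open>The Killing form\<close>

definition killing :: "'g \<Rightarrow> 'g \<Rightarrow> 'k" where
  "killing x y = trace (\<lambda>z. br x (br y z))"

lemma lin_br_br: "lin (\<lambda>z. br x (br y z))"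
  by (rule lin_compose[OF lin_br lin_br])

lemma killing_sym: "killing x y = killing y x"
  unfolding killing_def by (rule trace_commute[OF lin_br lin_br])

lemma killing_add_left: "killing (x + y) z = killing x z + killing y z"
  unfolding killing_def by (simp add: br_add_left trace_add)

lemma killing_scale_left: "killing (c *s x) z = c * killing x z"
  unfolding killing_def by (simp add: br_scale_left trace_scale)

lemma killing_diff_left: "killing (x - y) z = killing x z - killing y z"
  unfolding killing_def by (simp add: br_diff_left trace_diff)

lemma killing_add_right: "killing z (x + y) = killing z x + killing z y"
  using killing_add_left killing_sym by metis

lemma killing_scale_right: "killing z (c *s x) = c * killing z x"
  using killing_scale_left killing_sym by metis

lemma subspace_killing_kernel: "subspace {z. killing x z = 0}"
  by (rule subspaceI)
    (use killing_scale_right[of x 0 0] in \<open>auto simp: killing_add_right killing_scale_right\<close>)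

text \<open>Both sides expand into two triple products by the Jacobi identity. One product is
  common, and the others agree by cyclicity of the trace.\<close>

lemma killing_invariant: "killing (br x y) z = killing x (br y z)"
proof -
  have c: "br (br x y) w = br x (br y w) - br y (br x w)" for x y w
    using br_derivation[of x y w] by simp
  have "killing (br x y) z = trace (\<lambda>w. br x (br y (br z w))) - trace (\<lambda>w. br y (br x (br z w)))"
    unfolding killing_def c by (rule trace_diff)
  moreover have "killing x (br y z) = trace (\<lambda>w. br x (br y (br z w))) - trace (\<lambda>w. br x (br z (br y w)))"
    unfolding killing_def c by (simp add: br_simps trace_diff)
  moreover have "trace (\<lambda>w. br y (br x (br z w))) = trace (\<lambda>w. br x (br z (br y w)))"
    by (rule trace_commute[OF lin_br lin_br_br])
  ultimately show ?thesis
    by simp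
qed

text \<open>A positive element of \<open>t\<close> has integral eigenvalues that
  are not all zero, so it is not isotropic, and the radical of the form is a proper ideal.\<close>
lemma killing_nondegenerate:
  assumes "l \<ge> 1" and "\<And>z. killing x z = 0"
  shows "x = 0"
proof -
  let ?R = "{x. \<forall>z. killing x z = 0}"
  have "subspace ?R"
    using killing_scale_left[of 0 0]
    by (intro subspaceI) (auto simp: killing_add_left killing_scale_left)
  moreover have "br y x \<in> ?R" if "x \<in> ?R" for x y
  proof -
    have "killing (br y x) z = 0" for z
      using that killing_invariant[of x y z] br_anti[of y x] killing_scale_left[of "-1" "br x y" z]
      by simp
    then show ?thesis
      by simp
  qed
  ultimately have "ideal ?R"
    by (auto simp: ideal_def)
  then have "?R = {0} \<or> ?R = UNIV"
    by (rule simple)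
  moreover have "?R \<noteq> UNIV"
  proof -
    obtain h where h: "h \<in> t" "\<And>i. i \<in> {1..l} \<Longrightarrow> \<alpha> i h = 1"
      using prescribed_values[of "\<lambda>_. 1"] by blast
    then have s: "special h"
      by (auto simp: special_def intro!: exI[of _ 1])
    have "root_space t (\<alpha> 1) \<noteq> {0}"
      using alpha_root[of 1] assms(1) by (simp add: roots_def)
    then obtain v where v: "v \<in> root_space t (\<alpha> 1)" "v \<noteq> 0"
      using subspace_0[OF subspace_root_space] by blast
    then have "v \<in> gen_eigenspace (br h) 1"
      using h assms(1) by (intro eigenvector_in_gen_eigenspace) (simp add: root_space_def)
    then have "gen_eigenspace (br h) 1 \<noteq> {0}"
      using v(2) by blast
    then have "killing h h \<noteq> 0"
      unfolding killing_def
      using trace_square_nonzero[OF lin_br special_eigenvalue_int[OF s], where a = 1] by simp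
    then show ?thesis
      by blast
  qed
  ultimately show ?thesis
    using assms(2) by blast
qed

section \<open>Root space decomposition\<close>

text \<open>\<open>br x\<close> shifts generalized eigenspaces by \<open>a\<close>, and on each of
  them the semisimple part is a scalar.\<close>

lemma semisimple_part_derivation:
  assumes x: "x \<in> gen_eigenspace (br h) a"
  shows "semisimple_part (br h) (br x w) = br x (semisimple_part (br h) w) + a *s br x w"
proof (rule lin_eq_on_gen_eigenspaces[OF lin_br[of h],
      where F = "\<lambda>w. semisimple_part (br h) (br x w)"
        and G = "\<lambda>w. br x (semisimple_part (br h) w) + a *s br x w"])
  note D = lin_semisimple_part[OF lin_br[of h]]
  show "lin (\<lambda>w. semisimple_part (br h) (br x w))"
    by (rule lin_compose[OF D lin_br])
  show "lin (\<lambda>w. br x (semisimple_part (br h) w) + a *s br x w)"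
    by (rule linI) (simp_all add: br_simps endo.linear_add[OF D] endo.linear_scale[OF D]
        scale_right_distrib mult.commute)
next
  fix b w assume w: "w \<in> gen_eigenspace (br h) b"
  show "semisimple_part (br h) (br x w) = br x (semisimple_part (br h) w) + a *s br x w"
    using semisimple_part_eq[OF lin_br br_gen_eigenspace[OF x w]] semisimple_part_eq[OF lin_br w]
    by (simp add: br_simps scale_left_distrib add.commute)
qed

text \<open>The nilpotent part of \<open>ad h\<close> takes values in the radical of the Killing form.\<close>
lemma special_diagonalizable:
  assumes l: "l \<ge> 1" and h: "special h" and x: "x \<in> gen_eigenspace (br h) a"
  shows "br h x = a *s x"
proof -
  let ?D = "semisimple_part (br h)"
  let ?y = "shift (br h) a x"
  note D = lin_semisimple_part[OF lin_br[of h]]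
  have ht: "h \<in> t"
    using h by (simp add: special_def)
  have y: "?y \<in> gen_eigenspace (br h) a"
    using x gen_eigenspace_ad_stable[OF ht ht x]
    by (intro shift_in_subspace subspace_gen_eigenspace lin_br)
  have "killing ?y z = 0" if z: "z \<in> gen_eigenspace (br h) b" for b z
  \<comment> \<open>Unless the eigenvalues are opposite, the product of the two adjoint maps shifts
    eigenvalues by the nonzero a + b and has trace 0.\<close>
  proof (cases "b = - a")
    case False
    then have ab: "a + b \<noteq> 0"
      by (metis add_eq_0_iff)
    show ?thesis
      unfolding killing_def
    proof (rule trace_weight_shift[OF D lin_br_br _ ab])
      fix v
      show "?D (br ?y (br z v)) = br ?y (br z (?D v)) + (a + b) *s br ?y (br z v)"
        by (simp add: semisimple_part_derivation[OF y] semisimple_part_derivation[OF z] br_simps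
            scale_left_distrib add.assoc add.commute add.left_commute)
    qed
  next
    case True
    \<comment> \<open>By invariance K([h,x], z) = K(h, w), and as \<open>w\<close> lies in
      \<open>t\<close>, \<open>ad h\<close> may be replaced by its semisimple part D. Writing
      \<open>ad w\<close> as the commutator of \<open>ad x\<close> and \<open>ad z\<close> and
      moving D past \<open>ad x\<close> yields a K(x, z), since the other two traces cancel.\<close>
    define w where "w = br x z"
    have "w \<in> gen_eigenspace (br h) (a + b)"
      unfolding w_def by (rule br_gen_eigenspace[OF x z])
    then have w: "w \<in> t"
      using special_null_space[OF h] True by simp
    have "killing (br h x) z = killing h w"
      unfolding w_def by (rule killing_invariant)
    also have "\<dots> = trace (\<lambda>v. ?D (br w v))"
      unfolding killing_def by (rule trace_semisimple_part[OF lin_br lin_br ad_t_commute[OF ht w]])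
    also have "(\<lambda>v. ?D (br w v)) = (\<lambda>v. ?D (br x (br z v)) - ?D (br z (br x v)))"
    proof
      fix v
      have "br w v = br x (br z v) - br z (br x v)"
        unfolding w_def using br_derivation[of x z v] by simp
      then show "?D (br w v) = ?D (br x (br z v)) - ?D (br z (br x v))"
        by (simp add: endo.linear_diff[OF D])
    qed
    also have "trace \<dots> = trace (\<lambda>v. br x (?D (br z v))) + a * killing x z - trace (\<lambda>v. ?D (br z (br x v)))"
      by (simp add: trace_diff trace_add trace_scale killing_def semisimple_part_derivation[OF x])
    also have "trace (\<lambda>v. br x (?D (br z v))) = trace (\<lambda>v. ?D (br z (br x v)))"
      by (rule trace_commute[OF lin_br lin_compose[OF D lin_br]])
    finally show ?thesis
      by (simp add: shift_def killing_diff_left killing_scale_left)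
  qed
  then have "(\<Union>b\<in>UNIV. gen_eigenspace (br h) b) \<subseteq> {z. killing ?y z = 0}"
    by blast
  then have "span (\<Union>b\<in>UNIV. gen_eigenspace (br h) b) \<subseteq> {z. killing ?y z = 0}"
    by (rule span_minimal[OF _ subspace_killing_kernel])
  then have "killing ?y z = 0" for z
    using span_gen_eigenspaces[OF lin_br] by blast
  then have "?y = 0"
    by (rule killing_nondegenerate[OF l])
  then show ?thesis
    by (simp add: shift_def)
qed

text \<open>Special elements span \<open>t\<close>: \<open>h0\<close> has value 1 at every simple
  root, \<open>s k\<close> differs from it only by the value 2 at \<alpha>_k, and the differences
  are dual to the simple roots.\<close>

lemma special_combination:
  assumes S: "subspace S" "\<And>h. special h \<Longrightarrow> h \<in> S" and h: "h \<in> t"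
  shows "h \<in> S"
proof -
  obtain h0 where h0: "h0 \<in> t" "\<forall>i\<in>{1..l}. \<alpha> i h0 = 1"
    using prescribed_values[of "\<lambda>_. 1"] by blast
  have "\<exists>s\<in>t. \<forall>i\<in>{1..l}. \<alpha> i s = (if i = k then 2 else 1)" for k
    using prescribed_values[of "\<lambda>i. if i = k then 2 else 1"] by blast
  then obtain s where s: "\<And>k. s k \<in> t" "\<And>k i. i \<in> {1..l} \<Longrightarrow> \<alpha> i (s k) = (if i = k then 2 else 1)"
    by metis
  have "special h0"
    using h0 by (auto simp: special_def intro!: exI[of _ 1])
  moreover have "special (s k)" for k
    unfolding special_def
  proof (intro conjI ballI)
    show "s k \<in> t"
      by (rule s)
    fix i assume "i \<in> {1..l}"
    then have "\<alpha> i (s k) = of_nat (if i = k then 2 else 1)"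
      using s(2) by simp
    then show "\<exists>n>0. \<alpha> i (s k) = of_nat n"
      by (intro exI[of _ "if i = k then 2 else 1"]) simp
  qed
  ultimately have "(\<Sum>k=1..l. \<alpha> k h *s (s k - h0)) \<in> S"
    by (intro subspace_sum subspace_scale subspace_diff S)
  moreover have "h - (\<Sum>k=1..l. \<alpha> k h *s (s k - h0)) = 0"
  proof (rule simple_roots_separate)
    have in_t: "\<alpha> k h *s (s k - h0) \<in> t" for k
      by (intro subspace_scale subspace_diff subspace_t s h0)
    then have sum_t: "(\<Sum>k=1..l. \<alpha> k h *s (s k - h0)) \<in> t"
      by (intro subspace_sum subspace_t)
    then show "h - (\<Sum>k=1..l. \<alpha> k h *s (s k - h0)) \<in> t"
      by (intro subspace_diff subspace_t h)
    fix i assume i: "i \<in> {1..l}"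
    then have d: "\<alpha> i \<in> dual_space t"
      using alpha_root root_dual by blast
    have "\<alpha> i (\<Sum>k=1..l. \<alpha> k h *s (s k - h0)) = (\<Sum>k=1..l. \<alpha> i (\<alpha> k h *s (s k - h0)))"
      by (rule dual_sum[OF d in_t])
    also have "\<dots> = (\<Sum>k=1..l. if k = i then \<alpha> k h else 0)"
    proof (rule sum.cong)
      fix k
      show "\<alpha> i (\<alpha> k h *s (s k - h0)) = (if k = i then \<alpha> k h else 0)"
        using i s h0 by (simp add: dual_scale[OF d] dual_diff[OF d] subspace_diff[OF subspace_t])
    qed simp
    also have "\<dots> = \<alpha> i h"
      using i by (simp add: sum.delta)
    finally show "\<alpha> i (h - (\<Sum>k=1..l. \<alpha> k h *s (s k - h0))) = 0"
      unfolding dual_diff[OF d h sum_t] by simp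
  qed
  ultimately show ?thesis
    by simp
qed

text \<open>Take a minimal \<open>t\<close>-stable subspace not contained in the sum of the weight
  spaces. Each special element is diagonalizable, so by minimality it acts there by a scalar;
  special elements span \<open>t\<close>, so the subspace lies in a single weight space after
  all.\<close>

lemma root_decomposition:
  assumes l: "l \<ge> 1"
  shows "span (\<Union>\<gamma>\<in>weights. root_space t \<gamma>) = UNIV"
proof (rule ccontr)
  let ?W = "span (\<Union>\<gamma>\<in>weights. root_space t \<gamma>)"
  let ?Q = "\<lambda>U. \<not> U \<subseteq> ?W \<and> (\<forall>h\<in>t. \<forall>x\<in>U. br h x \<in> U)"
  assume "?W \<noteq> UNIV"
  then have "?Q UNIV"
    by auto
  from minimal_subspace[of UNIV ?Q, OF subspace_UNIV this]
  obtain U where "subspace U \<and> ?Q U \<and> (\<forall>V. subspace V \<longrightarrow> ?Q V \<longrightarrow> V \<subseteq> U \<longrightarrow> V = U)" ..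
  then have U: "subspace U" "?Q U"
    and min: "\<forall>V. subspace V \<longrightarrow> ?Q V \<longrightarrow> V \<subseteq> U \<longrightarrow> V = U"
    by (rule conjunct1, rule conjunct2[THEN conjunct1], rule conjunct2[THEN conjunct2])
  let ?S = "{h. \<exists>a. \<forall>x\<in>U. br h x = a *s x}"
  have "subspace ?S"
  proof (rule subspaceI)
    show "0 \<in> ?S"
      by (auto intro!: exI[of _ 0])
  next
    fix h k assume "h \<in> ?S" "k \<in> ?S"
    then obtain a b where "\<forall>x\<in>U. br h x = a *s x" "\<forall>x\<in>U. br k x = b *s x"
      by blast
    then show "h + k \<in> ?S"
      by (auto simp: br_add_left scale_left_distrib intro!: exI[of _ "a + b"])
  next
    fix c h assume "h \<in> ?S"
    then obtain a where "\<forall>x\<in>U. br h x = a *s x"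
      by blast
    then show "c *s h \<in> ?S"
      by (auto simp: br_scale_left intro!: exI[of _ "c * a"])
  qed
  moreover have "h \<in> ?S" if h: "special h" for h
  proof -
    have ht: "h \<in> t"
      using h by (simp add: special_def)
    have "U \<subseteq> span (\<Union>a. gen_eigenspace (br h) a \<inter> U)"
      by (rule gen_eigenspace_span[OF lin_br U(1)]) (use U(2) ht in blast)
    then obtain a where a: "\<not> gen_eigenspace (br h) a \<inter> U \<subseteq> ?W"
      using U(2) span_minimal[of "\<Union>a. gen_eigenspace (br h) a \<inter> U" ?W] by blast
    let ?V = "gen_eigenspace (br h) a \<inter> U"
    have "subspace ?V"
      by (intro subspace_inter subspace_gen_eigenspace lin_br U(1))
    moreover have "?Q ?V"
      using a U(2) gen_eigenspace_ad_stable[OF ht] by blast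
    ultimately have "?V = U"
      using min[rule_format, of ?V] by blast
    then have "\<forall>x\<in>U. br h x = a *s x"
      using special_diagonalizable[OF l h] by blast
    then show ?thesis
      by blast
  qed
  ultimately have scalar: "\<exists>a. \<forall>x\<in>U. br h x = a *s x" if "h \<in> t" for h
    using special_combination[of ?S h] that by blast
  have "U \<noteq> {0}"
    using U(2) span_zero by auto
  then obtain \<gamma> where "\<gamma> \<in> weights" "U \<subseteq> root_space t \<gamma>"
    using common_weight[OF U(1) _ scalar] by blast
  then have "U \<subseteq> ?W"
    using span_superset[of "\<Union>\<gamma>\<in>weights. root_space t \<gamma>"] by blast
  then show False
    using U(2) by blast
qed

lemma root_space_zero: "root_space t zero_form = t"
proof
  show "root_space t zero_form \<subseteq> t"
  proof
    fix x assume "x \<in> root_space t zero_form"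
    then have "br x h \<in> t" if "h \<in> t" for h
      using that br_anti[of x h] subspace_0[OF subspace_t] by (simp add: root_space_def)
    then have "x \<in> normalizer t"
      by (simp add: normalizer_def)
    then show "x \<in> t"
      using normalizer_t by simp
  qed
qed (rule t_le_root_space_zero)

text \<open>To show that the term of \<gamma> vanishes, an \<open>h\<close> with \<gamma>(h)
  different from \<beta>(h) is chosen for this \<gamma>; subtracting the scalar \<beta>(h) from
  \<open>ad h\<close> removes the term of \<beta> from the relation.\<close>

lemma direct_family_root_space: "direct_family (root_space t) weights"
  unfolding direct_family_def
proof (intro conjI allI impI)
  show "\<forall>\<gamma>\<in>weights. subspace (root_space t \<gamma>)"
    using subspace_root_space by blast
next
  fix K and u :: "('g \<Rightarrow> 'k) \<Rightarrow> 'g"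
  assume "finite K" "K \<subseteq> weights" "\<forall>\<gamma>\<in>K. u \<gamma> \<in> root_space t \<gamma>" "(\<Sum>\<gamma>\<in>K. u \<gamma>) = 0"
  then show "\<forall>\<gamma>\<in>K. u \<gamma> = 0"
  proof (induction K arbitrary: u)
    case (insert \<beta> K)
    have e: "shift (br h) a (u \<gamma>) = (\<gamma> h - a) *s u \<gamma>" if "h \<in> t" "\<gamma> \<in> insert \<beta> K" for h a \<gamma>
      using insert.prems that by (auto simp: shift_def root_space_def scale_left_diff_distrib)
    have "u \<gamma> = 0" if \<gamma>: "\<gamma> \<in> K" for \<gamma>
    proof -
      have "\<gamma> \<noteq> \<beta>"
        using \<gamma> insert.hyps by blast
      then obtain h where h: "h \<in> t" "\<gamma> h \<noteq> \<beta> h"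
        using dual_eqI[of \<gamma> \<beta>] weight_dual insert.prems(1) \<gamma> by blast
      let ?f = "shift (br h) (\<beta> h)"
      have l: "lin ?f"
        by (rule lin_shift[OF lin_br])
      have "?f (\<Sum>\<gamma>\<in>insert \<beta> K. u \<gamma>) = 0"
        using insert.prems(3) endo.linear_0[OF l] by simp
      then have "(\<Sum>\<gamma>\<in>K. ?f (u \<gamma>)) = 0"
        using insert.hyps e[OF h(1), of \<beta> "\<beta> h"] by (simp add: endo.linear_add[OF l] endo.linear_sum[OF l])
      moreover have "\<forall>\<gamma>\<in>K. ?f (u \<gamma>) \<in> root_space t \<gamma>"
        using e[OF h(1)] insert.prems(2) subspace_scale[OF subspace_root_space] by simp
      ultimately have "\<forall>\<gamma>\<in>K. ?f (u \<gamma>) = 0"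
        using insert.IH[of "\<lambda>\<gamma>. ?f (u \<gamma>)"] insert.prems(1) by blast
      then show ?thesis
        using e[OF h(1), of \<gamma> "\<beta> h"] \<gamma> h(2) by simp
    qed
    moreover from this have "u \<beta> = 0"
      using insert.prems(3) insert.hyps by simp
    ultimately show ?case
      by blast
  qed simp
qed

text \<open>By nondegeneracy a root vector for \<gamma> pairs nontrivially with a vector of some
  weight \<beta>, and invariance under \<open>t\<close> allows this only for \<beta> =
  -\<gamma>.\<close>

lemma negative_root:
  assumes l: "l \<ge> 1" and \<gamma>: "\<gamma> \<in> roots t"
  shows "\<exists>\<beta>\<in>roots t. \<forall>h\<in>t. \<beta> h = - \<gamma> h"
proof -
  obtain x where x: "x \<in> root_space t \<gamma>" "x \<noteq> 0"
    using \<gamma> subspace_0[OF subspace_root_space] unfolding roots_def by blast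
  obtain \<beta> z where z: "\<beta> \<in> weights" "z \<in> root_space t \<beta>" "killing x z \<noteq> 0"
  proof (rule ccontr)
    assume "\<not> thesis"
    then have "(\<Union>\<beta>\<in>weights. root_space t \<beta>) \<subseteq> {z. killing x z = 0}"
      using that by blast
    then have "span (\<Union>\<beta>\<in>weights. root_space t \<beta>) \<subseteq> {z. killing x z = 0}"
      by (rule span_minimal[OF _ subspace_killing_kernel])
    then have "killing x z = 0" for z
      using root_decomposition[OF l] by blast
    then show False
      using killing_nondegenerate[OF l] x(2) by blast
  qed
  have neg: "\<beta> h = - \<gamma> h" if h: "h \<in> t" for h
  proof -
    have "killing (br x h) z = killing x (br h z)"
      by (rule killing_invariant)
    moreover have "br x h = (- \<gamma> h) *s x"
      using x(1) h br_anti[of x h] by (simp add: root_space_def)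
    moreover have "br h z = \<beta> h *s z"
      using z(2) h by (simp add: root_space_def)
    ultimately have "- \<gamma> h * killing x z = \<beta> h * killing x z"
      by (simp only: killing_scale_left killing_scale_right)
    then have "- \<gamma> h = \<beta> h"
      by (rule mult_right_cancel[OF z(3), THEN iffD1])
    then show ?thesis
      by simp
  qed
  have "\<beta> \<noteq> zero_form"
  proof
    assume "\<beta> = zero_form"
    then have "\<gamma> = zero_form"
      using neg dual_eqI[OF root_dual[OF \<gamma>] zero_form_dual] by simp
    then show False
      using \<gamma> by (simp add: roots_def)
  qed
  then show ?thesis
    using z(1) neg by (auto simp: weights_def)
qed

section \<open>Centralizers of graded nilpotent elements\<close>

text \<open>The minimum of centralizer dimensions is compared with a special element, whose
  centralizer lies in \<open>t\<close>.\<close>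

lemma dim_centralizer_regular:
  assumes "regular e"
  shows "dim (centralizer e) \<le> dim t"
proof -
  obtain h where h: "h \<in> t" "\<forall>i\<in>{1..l}. \<alpha> i h = 1"
    using prescribed_values[of "\<lambda>_. 1"] by blast
  then have s: "special h"
    by (auto simp: special_def intro!: exI[of _ 1])
  have "centralizer h \<subseteq> t"
    using special_null_space[OF s] eigenvector_in_gen_eigenspace[of "br h" _ 0]
    by (auto simp: centralizer_def)
  then show ?thesis
    using assms dim_subset order.trans unfolding regular_def by blast
qed

lemma subspace_centralizer: "subspace (centralizer e)"
  unfolding centralizer_def by (rule endo.linear_subspace_kernel[OF lin_br])

section \<open>Sums of weight spaces\<close>

definition weight_sum :: "(('g \<Rightarrow> 'k) \<Rightarrow> bool) \<Rightarrow> 'g set" where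
  "weight_sum P = span (\<Union>\<gamma>\<in>{\<gamma>\<in>weights. P \<gamma>}. root_space t \<gamma>)"

lemma subspace_weight_sum: "subspace (weight_sum P)"
  by (simp add: weight_sum_def)

lemma root_space_le_weight_sum: "\<gamma> \<in> weights \<Longrightarrow> P \<gamma> \<Longrightarrow> root_space t \<gamma> \<subseteq> weight_sum P"
  unfolding weight_sum_def by (rule order.trans[OF _ span_superset]) blast

lemma weight_sum_minimal:
  "(\<And>\<gamma>. \<gamma> \<in> weights \<Longrightarrow> P \<gamma> \<Longrightarrow> root_space t \<gamma> \<subseteq> S) \<Longrightarrow> subspace S \<Longrightarrow> weight_sum P \<subseteq> S"
  unfolding weight_sum_def by (rule span_minimal) blast+

lemma weight_sum_mono:
  "(\<And>\<gamma>. \<gamma> \<in> weights \<Longrightarrow> P \<gamma> \<Longrightarrow> Q \<gamma>) \<Longrightarrow> weight_sum P \<subseteq> weight_sum Q"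
  by (intro weight_sum_minimal root_space_le_weight_sum subspace_weight_sum) simp_all

lemma weight_scaling_operator:
  assumes "l \<ge> 1"
  obtains D where "lin D" "\<And>\<gamma> x. \<gamma> \<in> weights \<Longrightarrow> x \<in> root_space t \<gamma> \<Longrightarrow> D x = c \<gamma> *s x"
  using scaling_operator[OF direct_family_root_space root_decomposition[OF assms], of c] by blast

text \<open>An operator acting by 1 where \<open>P\<close> holds and by 0 elsewhere separates the
  two sums.\<close>

lemma weight_sum_disjoint:
  assumes l: "l \<ge> 1" and PQ: "\<And>\<gamma>. \<gamma> \<in> weights \<Longrightarrow> P \<gamma> \<Longrightarrow> \<not> Q \<gamma>"
  shows "weight_sum P \<inter> weight_sum Q \<subseteq> {0}"
proof -
  obtain D where D: "lin D"
    "\<And>\<gamma> x. \<gamma> \<in> weights \<Longrightarrow> x \<in> root_space t \<gamma> \<Longrightarrow> D x = (if P \<gamma> then 1 else 0) *s x"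
    using weight_scaling_operator[OF l, of "\<lambda>\<gamma>. if P \<gamma> then 1 else 0"] by metis
  have "subspace {x. shift D 1 x = 0}"
    by (rule endo.linear_subspace_kernel[OF lin_shift[OF D(1)]])
  then have "weight_sum P \<subseteq> {x. shift D 1 x = 0}"
    by (intro weight_sum_minimal) (auto simp: shift_def D(2))
  moreover have "subspace {x. D x = 0}"
    by (rule endo.linear_subspace_kernel[OF D(1)])
  then have "weight_sum Q \<subseteq> {x. D x = 0}"
    using PQ by (intro weight_sum_minimal) (auto simp: D(2))
  ultimately have "D x = x" "D x = 0" if "x \<in> weight_sum P \<inter> weight_sum Q" for x
    using that by (auto simp: shift_def)
  then show ?thesis
    by fastforce
qed

text \<open>Split \<open>e\<close> into the part with scalar \<open>z\<close> and the rest. On the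
  rest f - z is invertible, but it kills that component of \<open>e\<close>.\<close>

lemma eigenvector_in_weight_sum:
  assumes l: "l \<ge> 1" and f: "lin f"
    and fc: "\<And>\<gamma> x. \<gamma> \<in> weights \<Longrightarrow> x \<in> root_space t \<gamma> \<Longrightarrow> f x = c \<gamma> *s x"
    and e: "f e = z *s e"
  shows "e \<in> weight_sum (\<lambda>\<gamma>. c \<gamma> = z)"
proof -
  \<comment> \<open>\<open>D\<close> inverts f - z on the weight spaces with scalar other than
    \<open>z\<close>; on those with scalar \<open>z\<close> the convention
    \<open>inverse 0 = 0\<close> makes it 0.\<close>
  obtain D where D: "lin D"
    "\<And>\<gamma> x. \<gamma> \<in> weights \<Longrightarrow> x \<in> root_space t \<gamma> \<Longrightarrow> D x = inverse (c \<gamma> - z) *s x"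
    using weight_scaling_operator[OF l, of "\<lambda>\<gamma>. inverse (c \<gamma> - z)"] by metis
  let ?A = "weight_sum (\<lambda>\<gamma>. c \<gamma> = z)" and ?B = "weight_sum (\<lambda>\<gamma>. c \<gamma> \<noteq> z)"
  have "UNIV = span (?A \<union> ?B)"
  proof -
    have "(\<Union>\<gamma>\<in>weights. root_space t \<gamma>) \<subseteq> ?A \<union> ?B"
      using root_space_le_weight_sum[of _ "\<lambda>\<gamma>. c \<gamma> = z"] root_space_le_weight_sum[of _ "\<lambda>\<gamma>. c \<gamma> \<noteq> z"]
      by blast
    then show ?thesis
      using root_decomposition[OF l] span_mono by blast
  qed
  then have "e \<in> span (?A \<union> ?B)"
    by blast
  then obtain a b where ab: "e = a + b" "a \<in> ?A" "b \<in> ?B"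
    unfolding span_Un span_eq_iff[THEN iffD2, OF subspace_weight_sum] by blast
  note sf = lin_shift[OF f, of z]
  have "?A \<subseteq> {x. shift f z x = 0}"
    by (intro weight_sum_minimal endo.linear_subspace_kernel[OF sf]) (auto simp: shift_def fc)
  then have "shift f z a = 0"
    using ab by blast
  moreover have "shift f z e = 0"
    using e by (simp add: shift_def)
  ultimately have sb: "shift f z b = 0"
    using ab(1) endo.linear_add[OF sf] by simp
  have Df: "lin (\<lambda>x. D (shift f z x))"
    by (rule lin_compose[OF D(1) sf])
  have "?B \<subseteq> {x. shift (\<lambda>x. D (shift f z x)) 1 x = 0}"
  proof (intro weight_sum_minimal endo.linear_subspace_kernel[OF lin_shift[OF Df]])
    fix \<gamma> assume \<gamma>: "\<gamma> \<in> weights" "c \<gamma> \<noteq> z"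
    show "root_space t \<gamma> \<subseteq> {x. shift (\<lambda>x. D (shift f z x)) 1 x = 0}"
    proof
      fix x assume x: "x \<in> root_space t \<gamma>"
      have "shift f z x = (c \<gamma> - z) *s x"
        using fc[OF \<gamma>(1) x] by (simp add: shift_def scale_left_diff_distrib)
      then have "D (shift f z x) = x"
        using D(2)[OF \<gamma>(1) x] \<gamma>(2) by (simp add: endo.linear_scale[OF D(1)])
      then show "x \<in> {x. shift (\<lambda>x. D (shift f z x)) 1 x = 0}"
        by (simp add: shift_def)
    qed
  qed
  then have "b = 0"
    using ab(3) sb endo.linear_0[OF D(1)] by (auto simp: shift_def[of "\<lambda>x. D (shift f z x)"])
  then show ?thesis
    using ab by simp
qed

lemma weightI: "\<gamma> \<in> dual_space t \<Longrightarrow> x \<in> root_space t \<gamma> \<Longrightarrow> x \<noteq> 0 \<Longrightarrow> \<gamma> \<in> weights"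
  by (auto simp: weights_def roots_def)

text \<open>A nonzero bracket of weight vectors has the sum of their weights as a weight. Linearity
  in each argument does the rest.\<close>

lemma br_weight_sum:
  assumes PQR: "\<And>\<beta> \<gamma>. \<beta> \<in> weights \<Longrightarrow> \<gamma> \<in> weights \<Longrightarrow> P \<beta> \<Longrightarrow> Q \<gamma> \<Longrightarrow> R (\<lambda>h. \<beta> h + \<gamma> h)"
    and e: "e \<in> weight_sum P" and x: "x \<in> weight_sum Q"
  shows "br e x \<in> weight_sum R"
proof -
  let ?R = "weight_sum R"
  have 1: "br u v \<in> ?R"
    if \<beta>: "\<beta> \<in> weights" "P \<beta>" "u \<in> root_space t \<beta>" and \<gamma>: "\<gamma> \<in> weights" "Q \<gamma>" "v \<in> root_space t \<gamma>"
    for \<beta> \<gamma> u v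
  proof (cases "br u v = 0")
    case True
    then show ?thesis
      using subspace_0[OF subspace_weight_sum] by simp
  next
    case False
    let ?s = "\<lambda>h. \<beta> h + \<gamma> h"
    have "?s \<in> dual_space t"
      using weight_dual[OF \<beta>(1)] weight_dual[OF \<gamma>(1)] by (simp add: dual_space_def algebra_simps)
    moreover have bs: "br u v \<in> root_space t ?s"
      using \<beta>(3) \<gamma>(3) br_derivation[of _ u v]
      by (auto simp: root_space_def br_simps scale_left_distrib)
    ultimately have "?s \<in> weights"
      using False weightI by blast
    then show ?thesis
      using root_space_le_weight_sum[of ?s R] PQR[OF \<beta>(1) \<gamma>(1) \<beta>(2) \<gamma>(2)] bs by blast
  qed
  have 2: "br u v \<in> ?R" if \<beta>: "\<beta> \<in> weights" "P \<beta>" "u \<in> root_space t \<beta>" and v: "v \<in> weight_sum Q"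
    for \<beta> u v
  proof -
    have "weight_sum Q \<subseteq> {v. br u v \<in> ?R}"
      using 1[OF \<beta>] endo.linear_subspace_linear_preimage[OF lin_br subspace_weight_sum]
      by (intro weight_sum_minimal) auto
    then show ?thesis
      using v by blast
  qed
  have "lin (\<lambda>u. br u x)"
    by (rule linI) (simp_all add: br_simps)
  then have "weight_sum P \<subseteq> {u. br u x \<in> ?R}"
    using 2[OF _ _ _ x] endo.linear_subspace_linear_preimage[OF _ subspace_weight_sum]
    by (intro weight_sum_minimal) auto
  then show ?thesis
    using e by blast
qed

text \<open>\<open>ad e\<close> raises the eigenvalue of \<open>y\<close> by one, so on the nonnegative part its rank is at most
  the dimension of the positive part.\<close>
lemma dim_null_part_le:
  assumes l: "l \<ge> 1" and e: "e \<in> weight_sum (\<lambda>\<gamma>. \<gamma> y = 1 \<and> \<gamma> u \<in> \<int>)"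
  shows "dim (weight_sum (\<lambda>\<gamma>. \<gamma> y = 0 \<and> \<gamma> u \<in> \<int>)) \<le> dim (weight_sum (\<lambda>\<gamma>. \<gamma> u \<in> \<int>) \<inter> centralizer e)"
proof -
  let ?N = "weight_sum (\<lambda>\<gamma>. \<gamma> y = 0 \<and> \<gamma> u \<in> \<int>)"
  \<comment> \<open>The degrees 1, 2, ... without 0. Since \<open>br e\<close> maps
    \<open>?S\<close> into \<open>?T\<close>, its kernel on \<open>?S\<close> has at least the
    dimension of \<open>?N\<close>.\<close>
  let ?T = "weight_sum (\<lambda>\<gamma>. (\<exists>n. \<gamma> y = of_nat (Suc n)) \<and> \<gamma> u \<in> \<int>)"
  let ?S = "weight_sum (\<lambda>\<gamma>. (\<exists>n. \<gamma> y = of_nat n) \<and> \<gamma> u \<in> \<int>)"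
  have "?N \<subseteq> ?S"
    by (rule weight_sum_mono) (metis of_nat_0)
  moreover have "?T \<subseteq> ?S"
    by (rule weight_sum_mono) blast
  ultimately have "{a + b |a b. a \<in> ?N \<and> b \<in> ?T} \<subseteq> ?S"
    using subspace_add[OF subspace_weight_sum] by blast
  then have "dim {a + b |a b. a \<in> ?N \<and> b \<in> ?T} \<le> dim ?S"
    by (rule dim_subset)
  moreover have "?N \<inter> ?T \<subseteq> {0}"
    by (rule weight_sum_disjoint[OF l]) (metis of_nat_neq_0)
  then have "dim {a + b |a b. a \<in> ?N \<and> b \<in> ?T} = dim ?N + dim ?T"
    by (rule dim_sum_disjoint[OF subspace_weight_sum subspace_weight_sum])
  moreover have "br e x \<in> ?T" if "x \<in> ?S" for x
    by (rule br_weight_sum[OF _ e that]) auto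
  then have "dim (br e ` ?S) \<le> dim ?T"
    by (intro dim_subset) blast
  moreover have "dim ?S \<le> dim (br e ` ?S) + dim {x\<in>?S. br e x = 0}"
    by (rule dim_le_image_kernel[OF lin_br subspace_weight_sum])
  moreover have "{x\<in>?S. br e x = 0} \<subseteq> weight_sum (\<lambda>\<gamma>. \<gamma> u \<in> \<int>) \<inter> centralizer e"
    using weight_sum_mono[of "\<lambda>\<gamma>. (\<exists>n. \<gamma> y = of_nat n) \<and> \<gamma> u \<in> \<int>" "\<lambda>\<gamma>. \<gamma> u \<in> \<int>"]
    by (auto simp: centralizer_def)
  then have "dim {x\<in>?S. br e x = 0} \<le> dim (weight_sum (\<lambda>\<gamma>. \<gamma> u \<in> \<int>) \<inter> centralizer e)"
    by (rule dim_subset)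
  ultimately show ?thesis
    by linarith
qed

lemma t_le_null_part: "t \<subseteq> weight_sum (\<lambda>\<gamma>. \<gamma> y = 0 \<and> \<gamma> u \<in> \<int>)"
  using root_space_le_weight_sum[of zero_form "\<lambda>\<gamma>. \<gamma> y = 0 \<and> \<gamma> u \<in> \<int>"] root_space_zero
  by (simp add: weights_def)

text \<open>The nilpotent operator \<open>ad e\<close> preserves the part of weights congruent to \<open>\<gamma>\<close>, where it has
  a kernel that is not counted by the previous bound.\<close>
lemma dim_centralizer_nonintegral:
  assumes l: "l \<ge> 1" and e: "e \<in> weight_sum (\<lambda>\<gamma>. \<gamma> y = 1 \<and> \<gamma> u \<in> \<int>)" and nil: "ad_nilpotent e"
    and \<gamma>: "\<gamma> \<in> roots t" "\<gamma> u \<notin> \<int>"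
  shows "dim t < dim (centralizer e)"
proof -
  let ?Z = "weight_sum (\<lambda>\<gamma>. \<gamma> u \<in> \<int>)"
  let ?K = "weight_sum (\<lambda>\<beta>. \<beta> u - \<gamma> u \<in> \<int>)"
  let ?C = "centralizer e"
  have \<gamma>w: "\<gamma> \<in> weights"
    using \<gamma>(1) by (simp add: weights_def)
  obtain w where w: "w \<in> root_space t \<gamma>" "w \<noteq> 0"
    using \<gamma>(1) subspace_0[OF subspace_root_space] unfolding roots_def by blast
  have wK: "w \<in> ?K"
    using root_space_le_weight_sum[OF \<gamma>w, of "\<lambda>\<beta>. \<beta> u - \<gamma> u \<in> \<int>"] w by auto
  have stable: "br e x \<in> ?K" if "x \<in> ?K" for x
  proof (rule br_weight_sum[OF _ e that])
    fix \<beta> \<beta>' :: "'g \<Rightarrow> 'k" assume "\<beta> y = 1 \<and> \<beta> u \<in> \<int>" "\<beta>' u - \<gamma> u \<in> \<int>"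
    then show "\<beta> u + \<beta>' u - \<gamma> u \<in> \<int>"
      by (metis Ints_add add_diff_eq)
  qed
  obtain n where n: "(br e ^^ n) w = 0"
    using nil by (auto simp: ad_nilpotent_def)
  \<comment> \<open>The last nonzero iterate of \<open>w\<close> is the extra element of the
    centralizer.\<close>
  define k where "k = (LEAST n. (br e ^^ n) w = 0)"
  have k: "(br e ^^ k) w = 0"
    unfolding k_def by (rule LeastI) (rule n)
  then have "k \<noteq> 0"
    using w(2) by (metis funpow_0)
  then obtain j where j: "k = Suc j"
    using not0_implies_Suc by blast
  let ?v = "(br e ^^ j) w"
  have "?v \<noteq> 0"
    using not_less_Least[of j "\<lambda>n. (br e ^^ n) w = 0"] j unfolding k_def by simp
  moreover have "?v \<in> ?K \<inter> ?C"
    using funpow_closed[of ?K "br e", OF stable wK] k j by (auto simp: centralizer_def)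
  ultimately have "dim (?K \<inter> ?C) \<noteq> 0"
    by auto
  moreover have "dim t \<le> dim (?Z \<inter> ?C)"
    using dim_null_part_le[OF l e] dim_subset[OF t_le_null_part] order.trans by blast
  \<comment> \<open>The two parts belong to different cosets of the integers, because \<gamma>(u) is
    not integral; their kernels therefore add up.\<close>
  moreover have "?Z \<inter> ?K \<subseteq> {0}"
  proof (rule weight_sum_disjoint[OF l])
    fix \<beta> :: "'g \<Rightarrow> 'k" assume "\<beta> u \<in> \<int>"
    then show "\<not> \<beta> u - \<gamma> u \<in> \<int>"
      using \<gamma>(2) by (metis Ints_diff diff_diff_eq2 add_diff_cancel_left')
  qed
  then have "dim {a + b |a b. a \<in> ?Z \<inter> ?C \<and> b \<in> ?K \<inter> ?C} = dim (?Z \<inter> ?C) + dim (?K \<inter> ?C)"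
    by (intro dim_sum_disjoint subspace_inter subspace_weight_sum subspace_centralizer) blast
  moreover have "dim {a + b |a b. a \<in> ?Z \<inter> ?C \<and> b \<in> ?K \<inter> ?C} \<le> dim ?C"
    using subspace_add[OF subspace_centralizer] by (intro dim_subset) blast
  ultimately show ?thesis
    by linarith
qed

text \<open>With 0 in place of \<open>u\<close> every weight is integral, so the earlier bound
  applies to the whole algebra. A root vector of degree 0 enlarges the null part beyond
  \<open>t\<close>.\<close>

lemma dim_centralizer_null_root:
  assumes l: "l \<ge> 1" and e: "e \<in> weight_sum (\<lambda>\<gamma>. \<gamma> y = 1)" and \<gamma>: "\<gamma> \<in> roots t" "\<gamma> y = 0"
  shows "dim t < dim (centralizer e)"
proof -
  let ?N = "weight_sum (\<lambda>\<gamma>. \<gamma> y = 0 \<and> \<gamma> 0 \<in> \<int>)"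
  have z: "\<beta> 0 \<in> \<int>" if "\<beta> \<in> weights" for \<beta>
    using dual_zero[OF weight_dual[OF that]] by simp
  have \<gamma>w: "\<gamma> \<in> weights"
    using \<gamma>(1) by (simp add: weights_def)
  obtain w where w: "w \<in> root_space t \<gamma>" "w \<noteq> 0"
    using \<gamma>(1) subspace_0[OF subspace_root_space] unfolding roots_def by blast
  have "w \<in> ?N"
    using root_space_le_weight_sum[OF \<gamma>w, of "\<lambda>\<gamma>. \<gamma> y = 0 \<and> \<gamma> 0 \<in> \<int>"] w \<gamma>(2) z[OF \<gamma>w] by auto
  moreover have "w \<notin> t"
  proof
    assume "w \<in> t"
    have "\<gamma> h = 0" if h: "h \<in> t" for h
    proof -
      have "br h w = \<gamma> h *s w"
        using w(1) h by (simp add: root_space_def)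
      moreover have "br h w = 0"
        by (rule t_abelian[OF h \<open>w \<in> t\<close>])
      ultimately show ?thesis
        using w(2) by simp
    qed
    then have "\<gamma> = zero_form"
      using dual_eqI[OF root_dual[OF \<gamma>(1)] zero_form_dual] by blast
    then show False
      using \<gamma>(1) by (simp add: roots_def)
  qed
  ultimately have "t \<subset> ?N"
    using t_le_null_part[of y 0] by blast
  then have "dim t < dim ?N"
    by (intro dim_psubset) (simp add: span_eq_iff[THEN iffD2] subspace_t subspace_weight_sum)
  also have "e \<in> weight_sum (\<lambda>\<gamma>. \<gamma> y = 1 \<and> \<gamma> 0 \<in> \<int>)"
    using e weight_sum_mono[of "\<lambda>\<gamma>. \<gamma> y = 1" "\<lambda>\<gamma>. \<gamma> y = 1 \<and> \<gamma> 0 \<in> \<int>"] z by blast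
  then have "dim ?N \<le> dim (centralizer e)"
    using dim_null_part_le[OF l] dim_subset[of "weight_sum (\<lambda>\<gamma>. \<gamma> 0 \<in> \<int>) \<inter> centralizer e" "centralizer e"]
      order.trans by blast
  finally show ?thesis .
qed

end

section \<open>Kac labels\<close>

lemma primitive_root_powi_eq_1:
  fixes \<zeta> :: "'a::field"
  assumes \<zeta>: "primitive_root_of_unity m \<zeta>" and k: "\<zeta> powi k = 1"
  shows "int m dvd k"
proof -
  have m: "m > 0" "\<zeta> ^ m = 1" "\<And>j. 0 < j \<Longrightarrow> j < m \<Longrightarrow> \<zeta> ^ j \<noteq> 1"
    using \<zeta> by (auto simp: primitive_root_of_unity_def)
  then have \<zeta>0: "\<zeta> \<noteq> 0"
    by (metis power_0_left zero_neq_one not_gr_zero)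
  let ?r = "nat (k mod int m)"
  have r: "int ?r = k mod int m"
    using m(1) by simp
  have "\<zeta> powi k = \<zeta> powi (int m * (k div int m) + int ?r)"
    unfolding r by simp
  also have "\<dots> = \<zeta> powi (int m * (k div int m)) * \<zeta> powi int ?r"
    by (rule power_int_add) (use \<zeta>0 in simp)
  also have "\<dots> = \<zeta> ^ ?r"
    using m(2) by (simp only: power_int_mult power_int_of_nat power_int_1_left mult_1)
  finally have "\<zeta> ^ ?r = 1"
    using k by simp
  moreover have "?r < m"
    using m(1) r by (metis of_nat_0_less_iff of_nat_less_iff pos_mod_bound)
  ultimately have "?r = 0"
    using m(3) by blast
  then show ?thesis
    using r by (simp add: dvd_eq_mod_eq_0)
qed

lemma inverse_of_nat_not_int:
  assumes "n > 1"
  shows "1 / of_nat n \<notin> (\<int> :: 'a::field_char_0 set)"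
proof
  assume "1 / of_nat n \<in> (\<int> :: 'a set)"
  then obtain k where "1 / of_nat n = (of_int k :: 'a)"
    by (auto elim: Ints_cases)
  then have "(1::'a) = of_int (k * int n)"
    using assms by (simp add: field_simps)
  then have "k * int n = 1"
    by (metis of_int_1 of_int_eq_iff)
  then show False
    using assms by (metis abs_zmult_eq_1 abs_of_nat mult.commute of_nat_1 of_nat_eq_iff less_irrefl)
qed

section \<open>Inner automorphisms and coefficients of roots\<close>

context cartan_setting
begin

text \<open>The index set in \<open>exp_ad x y\<close> depends on \<open>y\<close>; a uniform
  nilpotency exponent replaces it by a fixed range.\<close>

lemma lin_exp_ad:
  assumes "ad_nilpotent x"
  shows "lin (exp_ad x)"
proof -
  obtain n where n: "\<And>y. (br x ^^ n) y = 0"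
    using assms by (auto simp: ad_nilpotent_def)
  have e: "exp_ad x y = (\<Sum>k<n. inverse (of_nat (fact k)) *s (br x ^^ k) y)" for y
    unfolding exp_ad_def
  proof (rule sum.mono_neutral_left)
    show "{k. (br x ^^ k) y \<noteq> 0} \<subseteq> {..<n}"
      using funpow_lin_zero[OF lin_br n] by (auto simp: not_le[symmetric])
  qed auto
  have l: "lin (br x ^^ k)" for k
    by (rule lin_funpow[OF lin_br])
  show ?thesis
    by (rule linI) (simp_all add: e endo.linear_add[OF l] endo.linear_scale[OF l]
        scale_right_distrib sum.distrib scale_sum_right mult.commute)
qed

lemma lin_inner_automorphism: "inner_automorphism \<theta> \<Longrightarrow> lin \<theta>"
proof (induction rule: inner_automorphism.induct)
  case inner_id
  show ?case
    by (rule linI) simp_all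
next
  case (inner_exp x \<phi>)
  then show ?case
    using lin_compose[OF lin_exp_ad] by (simp add: o_def)
qed

text \<open>Independence over the field determines the coefficients as scalars, and characteristic 0
  determines the integers themselves.\<close>

lemma root_coeff_eqI:
  assumes c: "\<And>i. i \<notin> {1..l} \<Longrightarrow> c i = 0" "\<And>h. h \<in> t \<Longrightarrow> \<gamma> h = (\<Sum>i=1..l. of_int (c i) * \<alpha> i h)"
  shows "root_coeff t l \<alpha> \<gamma> = c"
  unfolding root_coeff_def
proof (rule the_equality)
  show "(\<forall>i. i \<notin> {1..l} \<longrightarrow> c i = 0) \<and> (\<forall>h\<in>t. \<gamma> h = (\<Sum>i=1..l. of_int (c i) * \<alpha> i h))"
    using c by blast
next
  fix d :: "nat \<Rightarrow> int"
  assume d: "(\<forall>i. i \<notin> {1..l} \<longrightarrow> d i = 0) \<and> (\<forall>h\<in>t. \<gamma> h = (\<Sum>i=1..l. of_int (d i) * \<alpha> i h))"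
  show "d = c"
  proof
    fix i
    show "d i = c i"
    proof (cases "i \<in> {1..l}")
      case True
      have "of_int (d i - c i) = (0::'k)"
      proof (rule simple_roots_independent[of "\<lambda>i. of_int (d i - c i)", OF _ True])
        fix h assume h: "h \<in> t"
        have "(\<Sum>i=1..l. of_int (d i) * \<alpha> i h) = (\<Sum>i=1..l. of_int (c i) * \<alpha> i h)"
          using c(2)[OF h] d h by metis
        then show "(\<Sum>i=1..l. of_int (d i - c i) * \<alpha> i h) = 0"
          by (simp add: left_diff_distrib sum_subtractf)
      qed
      then show ?thesis
        by (simp only: of_int_eq_0_iff right_minus_eq)
    next
      case False
      then show ?thesis
        using c(1) d by simp
    qed
  qed
qed

lemma root_coeff_root:
  assumes "\<gamma> \<in> roots t"
  shows root_coeff_outside: "i \<notin> {1..l} \<Longrightarrow> root_coeff t l \<alpha> \<gamma> i = 0"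
    and root_expansion: "h \<in> t \<Longrightarrow> \<gamma> h = (\<Sum>i=1..l. of_int (root_coeff t l \<alpha> \<gamma> i) * \<alpha> i h)"
    and root_sign: "(\<forall>i. root_coeff t l \<alpha> \<gamma> i \<ge> 0) \<or> (\<forall>i. root_coeff t l \<alpha> \<gamma> i \<le> 0)"
proof -
  obtain c :: "nat \<Rightarrow> int" where c: "\<forall>h\<in>t. \<gamma> h = (\<Sum>i=1..l. of_int (c i) * \<alpha> i h)"
    "(\<forall>i\<in>{1..l}. c i \<ge> 0) \<or> (\<forall>i\<in>{1..l}. c i \<le> 0)"
    using root_combination[OF assms] by meson
  let ?c = "\<lambda>i. if i \<in> {1..l} then c i else 0"
  have e: "root_coeff t l \<alpha> \<gamma> = ?c"
  proof (rule root_coeff_eqI)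
    fix h assume h: "h \<in> t"
    have "(\<Sum>i=1..l. of_int (c i) * \<alpha> i h) = (\<Sum>i=1..l. of_int (?c i) * \<alpha> i h)"
      by (rule sum.cong) simp_all
    then show "\<gamma> h = (\<Sum>i=1..l. of_int (?c i) * \<alpha> i h)"
      using c(1) h by simp
  qed (simp only: if_False)
  show "i \<notin> {1..l} \<Longrightarrow> root_coeff t l \<alpha> \<gamma> i = 0"
    by (simp only: e if_False)
  show "h \<in> t \<Longrightarrow> \<gamma> h = (\<Sum>i=1..l. of_int (root_coeff t l \<alpha> \<gamma> i) * \<alpha> i h)"
    using c(1) by (simp add: e)
  show "(\<forall>i. root_coeff t l \<alpha> \<gamma> i \<ge> 0) \<or> (\<forall>i. root_coeff t l \<alpha> \<gamma> i \<le> 0)"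
    using c(2) by (auto simp: e)
qed

text \<open>The index \<open>i\<close> may be 0, the affine node; the coefficient is then 0 and so
  is the sum.\<close>

lemma sum_root_coeff_delta:
  assumes "\<gamma> \<in> roots t"
  shows "(\<Sum>k=1..l. if k = i then of_int (root_coeff t l \<alpha> \<gamma> k) * c else 0)
    = of_int (root_coeff t l \<alpha> \<gamma> i) * c"
proof (cases "i \<in> {1..l}")
  case True
  then show ?thesis
    by (simp add: sum.delta)
next
  case False
  then have "root_coeff t l \<alpha> \<gamma> i = 0"
    by (rule root_coeff_outside[OF assms])
  then show ?thesis
    by (simp add: sum.delta)
qed

lemma root_coeff_negative:
  assumes "\<gamma> \<in> roots t" "\<And>h. h \<in> t \<Longrightarrow> \<beta> h = - \<gamma> h"
  shows "root_coeff t l \<alpha> \<beta> i = - root_coeff t l \<alpha> \<gamma> i"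
proof -
  have "root_coeff t l \<alpha> \<beta> = (\<lambda>i. - root_coeff t l \<alpha> \<gamma> i)"
    by (rule root_coeff_eqI) (simp_all add: assms(2) root_expansion[OF assms(1)]
        root_coeff_outside[OF assms(1)] sum_negf)
  then show ?thesis
    by simp
qed

lemma root_coeff_simple:
  assumes "k \<in> {1..l}"
  shows "root_coeff t l \<alpha> (\<alpha> k) i = (if i = k then 1 else 0)"
proof -
  have "root_coeff t l \<alpha> (\<alpha> k) = (\<lambda>i. if i = k then 1 else 0)"
  proof (rule root_coeff_eqI)
    fix h
    have "(\<Sum>i=1..l. of_int (if i = k then 1 else 0) * \<alpha> i h) = (\<Sum>i=1..l. if i = k then \<alpha> i h else 0)"
      by (rule sum.cong) simp_all
    then show "\<alpha> k h = (\<Sum>i=1..l. of_int (if i = k then 1 else 0) * \<alpha> i h)"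
      using assms by (simp add: sum.delta)
  qed (use assms in auto)
  then show ?thesis
    by simp
qed

end

section \<open>Degrees of roots for given Kac labels\<close>

locale kac_setting = cartan_setting scale br Basis t l \<alpha>
  for scale :: "'k::{alg_closed_field, field_char_0} \<Rightarrow> 'g::ab_group_add \<Rightarrow> 'g" (infixr "*s" 75)
    and br :: "'g \<Rightarrow> 'g \<Rightarrow> 'g" and Basis t l \<alpha> +
  fixes \<delta> :: "'g \<Rightarrow> 'k" and p :: "nat \<Rightarrow> nat" and m :: nat
  assumes highest: "highest_root t l \<alpha> \<delta>"
    and rank_pos: "l \<ge> 1"
    and order_eq: "m = (\<Sum>i=0..l. mark t l \<alpha> \<delta> i * p i)"
begin

abbreviation coeff_at :: "('g \<Rightarrow> 'k) \<Rightarrow> nat \<Rightarrow> int" where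
  "coeff_at \<equiv> root_coeff t l \<alpha>"

abbreviation n :: "nat \<Rightarrow> nat" where
  "n \<equiv> mark t l \<alpha> \<delta>"

abbreviation degree_of :: "('g \<Rightarrow> 'k) \<Rightarrow> int" where
  "degree_of \<equiv> kac_degree t l \<alpha> p"

lemma delta_root: "\<delta> \<in> roots t"
  using highest by (simp add: highest_root_def)

lemma coeff_le_delta: "\<gamma> \<in> roots t \<Longrightarrow> k \<in> {1..l} \<Longrightarrow> coeff_at \<gamma> k \<le> coeff_at \<delta> k"
  using highest by (simp add: highest_root_def)

lemma mark_zero: "n 0 = 1"
  by (simp add: mark_def)

lemma mark_pos:
  assumes "k \<in> {1..l}"
  shows "int (n k) = coeff_at \<delta> k" and "n k \<ge> 1"
proof -
  have "coeff_at \<delta> k \<ge> 1"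
    using coeff_le_delta[OF alpha_root[OF assms] assms] root_coeff_simple[OF assms, of k] by simp
  then show "int (n k) = coeff_at \<delta> k" and "n k \<ge> 1"
    using assms by (auto simp: mark_def)
qed

lemma mark_ge_1: "k \<in> {0..l} \<Longrightarrow> n k \<ge> 1"
  using mark_pos(2)[of k] mark_zero by (cases "k = 0") auto

lemma coeff_at_0: "\<gamma> \<in> roots t \<Longrightarrow> coeff_at \<gamma> 0 = 0"
  by (rule root_coeff_outside) auto

lemma coeff_le_mark: "\<gamma> \<in> roots t \<Longrightarrow> k \<in> {0..l} \<Longrightarrow> coeff_at \<gamma> k \<le> int (n k)"
  using coeff_le_delta[of \<gamma> k] mark_pos(1)[of k] coeff_at_0 by (cases "k = 0") auto

lemma degree_of_eq: "\<gamma> \<in> roots t \<Longrightarrow> degree_of \<gamma> = (\<Sum>k=0..l. coeff_at \<gamma> k * int (p k))"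
  by (simp add: kac_degree_def sum.atLeast_Suc_atMost coeff_at_0)

text \<open>For a positive root \<gamma> this expresses the degree of the affine root attached to
  -\<gamma> by the affine simple roots, whose multiplicities n_k - [\<gamma>:\<alpha>_k] are
  nonnegative.\<close>

lemma order_minus_degree:
  "\<gamma> \<in> roots t \<Longrightarrow> int m - degree_of \<gamma> = (\<Sum>k=0..l. (int (n k) - coeff_at \<gamma> k) * int (p k))"
  by (simp add: degree_of_eq order_eq sum_subtractf left_diff_distrib)

lemma label_le_order: "i \<in> {0..l} \<Longrightarrow> p i \<le> m"
proof -
  assume i: "i \<in> {0..l}"
  have "p i \<le> n i * p i"
    using mark_ge_1[OF i] by simp
  also have "\<dots> \<le> m"
    unfolding order_eq by (rule member_le_sum) (use i in auto)
  finally show ?thesis .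
qed

lemma positive_root_degree:
  assumes \<gamma>: "\<gamma> \<in> roots t" "\<And>k. coeff_at \<gamma> k \<ge> 0"
  shows "0 \<le> degree_of \<gamma>" and "degree_of \<gamma> \<le> int m"
    and "i \<in> {0..l} \<Longrightarrow> coeff_at \<gamma> i * int (p i) \<le> degree_of \<gamma>"
    and "i \<in> {0..l} \<Longrightarrow> (int (n i) - coeff_at \<gamma> i) * int (p i) \<le> int m - degree_of \<gamma>"
proof -
  have nn: "(int (n k) - coeff_at \<gamma> k) * int (p k) \<ge> 0" if "k \<in> {0..l}" for k
    using coeff_le_mark[OF \<gamma>(1) that] by simp
  show "0 \<le> degree_of \<gamma>"
    unfolding degree_of_eq[OF \<gamma>(1)] using \<gamma>(2) by (intro sum_nonneg) simp
  have "0 \<le> int m - degree_of \<gamma>"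
    unfolding order_minus_degree[OF \<gamma>(1)] using nn by (intro sum_nonneg) simp
  then show "degree_of \<gamma> \<le> int m"
    by simp
  show "i \<in> {0..l} \<Longrightarrow> coeff_at \<gamma> i * int (p i) \<le> degree_of \<gamma>"
    unfolding degree_of_eq[OF \<gamma>(1)]
    by (rule member_le_sum[where f = "\<lambda>k. coeff_at \<gamma> k * int (p k)"]) (use \<gamma>(2) in auto)
  show "i \<in> {0..l} \<Longrightarrow> (int (n i) - coeff_at \<gamma> i) * int (p i) \<le> int m - degree_of \<gamma>"
    unfolding order_minus_degree[OF \<gamma>(1)]
    by (rule member_le_sum[where f = "\<lambda>k. (int (n k) - coeff_at \<gamma> k) * int (p k)"]) (use nn in auto)
qed

text \<open>Degrees of positive roots lie between 0 and m, those of negative roots between -m and 0,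
  so the congruence leaves only 1 and 1 - m. Either way 1 is a sum of labels with nonnegative
  coefficients, [\<gamma>:\<alpha>_k] or n_k + [\<gamma>:\<alpha>_k], and a label above 1 must have
  coefficient 0.\<close>

lemma degree_congruent_1:
  assumes \<gamma>: "\<gamma> \<in> roots t" and dvd: "int m dvd degree_of \<gamma> - 1" and m: "m \<ge> 2"
  shows "(degree_of \<gamma> = 1 \<and> (\<forall>i\<in>{0..l}. p i > 1 \<longrightarrow> coeff_at \<gamma> i = 0)) \<or>
    (degree_of \<gamma> = 1 - int m \<and> (\<forall>i\<in>{0..l}. p i > 1 \<longrightarrow> i \<ge> 1 \<and> coeff_at \<gamma> i = - int (n i)))"
  using root_sign[OF \<gamma>]
proof
  assume pos: "\<forall>i. coeff_at \<gamma> i \<ge> 0"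
  note P = positive_root_degree[OF \<gamma> pos[rule_format]]
  obtain k where k: "degree_of \<gamma> - 1 = int m * k"
    using dvd by (elim dvdE)
  have "k = 0"
  proof (rule ccontr)
    assume "k \<noteq> 0"
    then consider "k \<ge> 1" | "k \<le> -1"
      by linarith
    then show False
    proof cases
      case 1
      then have "int m * 1 \<le> int m * k"
        by (intro mult_left_mono) auto
      then show False
        using P(2) k by linarith
    next
      case 2
      then have "int m * k \<le> int m * (-1)"
        by (intro mult_left_mono) auto
      then show False
        using P(1) k m by linarith
    qed
  qed
  then have d: "degree_of \<gamma> = 1"
    using k by simp
  have "coeff_at \<gamma> i = 0" if i: "i \<in> {0..l}" "p i > 1" for i
  proof (rule ccontr)
    assume "coeff_at \<gamma> i \<noteq> 0"
    then have "coeff_at \<gamma> i \<ge> 1"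
      using pos[rule_format, of i] by linarith
    then have "1 * int (p i) \<le> coeff_at \<gamma> i * int (p i)"
      by (intro mult_right_mono) auto
    then show False
      using P(3)[OF i(1)] d i(2) by linarith
  qed
  then show ?thesis
    using d by blast
next
  assume neg: "\<forall>i. coeff_at \<gamma> i \<le> 0"
  obtain \<beta> where \<beta>: "\<beta> \<in> roots t" "\<And>h. h \<in> t \<Longrightarrow> \<beta> h = - \<gamma> h"
    using negative_root[OF rank_pos \<gamma>] by blast
  have c: "coeff_at \<beta> k = - coeff_at \<gamma> k" for k
    by (rule root_coeff_negative[OF \<gamma> \<beta>(2)])
  have deg: "degree_of \<beta> = - degree_of \<gamma>"
    by (simp add: kac_degree_def c sum_negf)
  have pos: "coeff_at \<beta> k \<ge> 0" for k
    using neg c by simp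
  note P = positive_root_degree[OF \<beta>(1) pos]
  obtain k where k: "degree_of \<gamma> - 1 = int m * k"
    using dvd by (elim dvdE)
  have "k = -1"
  proof (rule ccontr)
    assume "k \<noteq> -1"
    then consider "k \<ge> 0" | "k \<le> -2"
      by linarith
    then show False
    proof cases
      case 1
      then have "0 \<le> int m * k"
        by simp
      then show False
        using P(1) k deg by linarith
    next
      case 2
      then have "int m * k \<le> int m * (-2)"
        by (intro mult_left_mono) auto
      then show False
        using P(2) k deg m by linarith
    qed
  qed
  then have d: "degree_of \<gamma> = 1 - int m"
    using k by simp
  have "i \<ge> 1 \<and> coeff_at \<gamma> i = - int (n i)" if i: "i \<in> {0..l}" "p i > 1" for i
  proof -
    have "coeff_at \<beta> i = int (n i)"
    proof (rule ccontr)
      assume "coeff_at \<beta> i \<noteq> int (n i)"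
      then have "int (n i) - coeff_at \<beta> i \<ge> 1"
        using coeff_le_mark[OF \<beta>(1) i(1)] by linarith
      then have "1 * int (p i) \<le> (int (n i) - coeff_at \<beta> i) * int (p i)"
        by (intro mult_right_mono) auto
      then show False
        using P(4)[OF i(1)] d deg i(2) by linarith
    qed
    \<comment> \<open>For a negative root \<alpha>_0 enters with coefficient n_0 = 1, so p_0 cannot
      exceed 1 in this case.\<close>
    moreover from this have "i \<noteq> 0"
      using coeff_at_0[OF \<beta>(1)] mark_zero by (cases "i = 0") auto
    ultimately show ?thesis
      using c by simp
  qed
  then show ?thesis
    using d by blast
qed

text \<open>The affine simple roots \<open>\<alpha> k\<close> with \<open>k \<noteq> i\<close>, including \<open>\<alpha> 0 = - \<delta>\<close>, take the values
  \<open>p k\<close> at \<open>y\<close>.\<close>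
lemma grading_element:
  assumes i: "i \<in> {0..l}"
  obtains y where "\<And>\<gamma>. \<gamma> \<in> roots t \<Longrightarrow>
    \<gamma> y = of_int (degree_of \<gamma>) - of_int (coeff_at \<gamma> i) * (of_nat m / of_nat (n i))"
proof -
  \<comment> \<open>Lowering the value at \<alpha>_i by m/n_i lowers that of \<delta> from m - p_0
    to -p_0, which gives \<alpha>_0 the value p_0. For \<open>i = 0\<close> no simple root is
    changed.\<close>
  let ?q = "of_nat m / of_nat (n i) :: 'k"
  obtain y where y: "y \<in> t" "\<And>k. k \<in> {1..l} \<Longrightarrow> \<alpha> k y = of_nat (p k) - (if k = i then ?q else 0)"
    using prescribed_values[of "\<lambda>k. of_nat (p k) - (if k = i then ?q else 0)"] by blast
  have "\<gamma> y = of_int (degree_of \<gamma>) - of_int (coeff_at \<gamma> i) * ?q" if \<gamma>: "\<gamma> \<in> roots t" for \<gamma>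
  proof -
    have "\<gamma> y = (\<Sum>k=1..l. of_int (coeff_at \<gamma> k) * (of_nat (p k) - (if k = i then ?q else 0)))"
      using y by (simp add: root_expansion[OF \<gamma> y(1)])
    also have "\<dots> = (\<Sum>k=1..l. of_int (coeff_at \<gamma> k) * of_nat (p k))
        - (\<Sum>k=1..l. if k = i then of_int (coeff_at \<gamma> k) * ?q else 0)"
      unfolding sum_subtractf[symmetric] by (rule sum.cong) (simp_all add: right_diff_distrib)
    also have "(\<Sum>k=1..l. if k = i then of_int (coeff_at \<gamma> k) * ?q else 0) = of_int (coeff_at \<gamma> i) * ?q"
      by (rule sum_root_coeff_delta[OF \<gamma>])
    finally show ?thesis
      by (simp add: kac_degree_def)
  qed
  then show thesis
    using that by blast
qed

text \<open>Source of the elements \<open>u\<close>: the second value \<open>b\<close> serves to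
  compensate the first one on the negative roots occurring in \<open>e\<close>. An index 0
  contributes nothing.\<close>

lemma coefficient_element:
  obtains u where "\<And>\<gamma>. \<gamma> \<in> roots t \<Longrightarrow>
    \<gamma> u = of_int (coeff_at \<gamma> j) * a + of_int (coeff_at \<gamma> i) * b"
proof -
  obtain u where u: "u \<in> t"
    "\<And>k. k \<in> {1..l} \<Longrightarrow> \<alpha> k u = (if k = j then a else 0) + (if k = i then b else 0)"
    using prescribed_values[of "\<lambda>k. (if k = j then a else 0) + (if k = i then b else 0)"] by blast
  have "\<gamma> u = of_int (coeff_at \<gamma> j) * a + of_int (coeff_at \<gamma> i) * b" if \<gamma>: "\<gamma> \<in> roots t" for \<gamma>
  proof -
    have "\<gamma> u = (\<Sum>k=1..l. of_int (coeff_at \<gamma> k) * ((if k = j then a else 0) + (if k = i then b else 0)))"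
      using u by (simp add: root_expansion[OF \<gamma> u(1)])
    also have "\<dots> = (\<Sum>k=1..l. if k = j then of_int (coeff_at \<gamma> k) * a else 0)
        + (\<Sum>k=1..l. if k = i then of_int (coeff_at \<gamma> k) * b else 0)"
      unfolding sum.distrib[symmetric] by (rule sum.cong) (simp_all add: distrib_left)
    finally show ?thesis
      unfolding sum_root_coeff_delta[OF \<gamma>] .
  qed
  then show thesis
    using that by blast
qed

text \<open>Each forbidden configuration contradicts one of two facts about all roots:
  \<open>bound\<close>, that \<open>u\<close> is integral everywhere once it is so on the roots of
  \<open>e\<close>, and \<open>null\<close>, that no root has degree 0 at \<open>y\<close>.\<close>

lemma regular_nilpotent_labels:
  assumes \<theta>: "kac_automorphism t l \<alpha> \<zeta> p \<theta>" and \<zeta>: "primitive_root_of_unity m \<zeta>"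
    and e: "\<theta> e = \<zeta> *s e" and nil: "ad_nilpotent e" and dim: "dim (centralizer e) \<le> dim t"
    and i: "i \<in> {0..l}" "p i > 1"
  shows "n i = 1" and "j \<in> {0..l} \<Longrightarrow> j \<noteq> i \<Longrightarrow> p j = 1"
proof -
  note l = rank_pos
  have m: "m \<ge> 2"
    using label_le_order[OF i(1)] i(2) by linarith
  have ni: "n i \<ge> 1"
    by (rule mark_ge_1[OF i(1)])
  have \<zeta>1: "\<zeta> \<noteq> 1" and \<zeta>0: "\<zeta> \<noteq> 0"
    using \<zeta> m by (auto simp: primitive_root_of_unity_def power_0_left dest: spec[of _ 1])
  define R where "R = (\<lambda>\<gamma>. \<gamma> \<in> roots t \<and> ((degree_of \<gamma> = 1 \<and> (\<forall>i\<in>{0..l}. p i > 1 \<longrightarrow> coeff_at \<gamma> i = 0)) \<or>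
    (degree_of \<gamma> = 1 - int m \<and> (\<forall>i\<in>{0..l}. p i > 1 \<longrightarrow> i \<ge> 1 \<and> coeff_at \<gamma> i = - int (n i)))))"
  have eR: "e \<in> weight_sum R"
  proof -
    let ?c = "\<lambda>\<gamma>. if \<gamma> = zero_form then 1 else \<zeta> powi degree_of \<gamma>"
    have "lin \<theta>"
      using \<theta> lin_inner_automorphism by (simp add: kac_automorphism_def)
    moreover have "\<theta> x = ?c \<gamma> *s x" if "\<gamma> \<in> weights" "x \<in> root_space t \<gamma>" for \<gamma> x
      using \<theta> that root_space_zero by (auto simp: kac_automorphism_def weights_def)
    ultimately have "e \<in> weight_sum (\<lambda>\<gamma>. ?c \<gamma> = \<zeta>)"
      using e by (rule eigenvector_in_weight_sum[OF l, where f = \<theta> and c = ?c])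
    moreover have "R \<gamma>" if \<gamma>: "\<gamma> \<in> weights" "?c \<gamma> = \<zeta>" for \<gamma>
    proof -
      \<comment> \<open>The zero weight is excluded because \<open>\<theta>\<close> fixes
        \<open>t\<close> pointwise and \<zeta> is not 1.\<close>
      have r: "\<gamma> \<in> roots t" "\<zeta> powi degree_of \<gamma> = \<zeta>"
        using \<gamma> \<zeta>1 by (auto simp: weights_def split: if_splits)
      then have "\<zeta> powi (degree_of \<gamma> - 1) = 1"
        using \<zeta>0 by (simp add: power_int_diff)
      then have "int m dvd degree_of \<gamma> - 1"
        by (rule primitive_root_powi_eq_1[OF \<zeta>])
      then show ?thesis
        unfolding R_def using degree_congruent_1[OF r(1) _ m] r(1) by blast
    qed
    ultimately show ?thesis
      using weight_sum_mono[of "\<lambda>\<gamma>. ?c \<gamma> = \<zeta>" R] by blast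
  qed
  obtain y where y: "\<And>\<gamma>. \<gamma> \<in> roots t \<Longrightarrow>
      \<gamma> y = of_int (degree_of \<gamma>) - of_int (coeff_at \<gamma> i) * (of_nat m / of_nat (n i))"
    using grading_element[OF i(1)] by blast
  \<comment> \<open>Positive roots of \<open>R\<close> give 1 - 0, negative ones 1 - m + n_i
    (m/n_i).\<close>
  have Ry: "\<gamma> y = 1" if "R \<gamma>" for \<gamma>
    using that i ni by (auto simp: R_def y)
  have bound: "\<gamma> u \<in> \<int>" if Ru: "\<And>\<gamma>. R \<gamma> \<Longrightarrow> \<gamma> u \<in> \<int>" and \<gamma>: "\<gamma> \<in> roots t" for u \<gamma>
  proof (rule ccontr)
    assume "\<gamma> u \<notin> \<int>"
    moreover have "e \<in> weight_sum (\<lambda>\<gamma>. \<gamma> y = 1 \<and> \<gamma> u \<in> \<int>)"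
      using eR weight_sum_mono[of R "\<lambda>\<gamma>. \<gamma> y = 1 \<and> \<gamma> u \<in> \<int>"] Ry Ru by blast
    ultimately show False
      using dim_centralizer_nonintegral[OF l _ nil \<gamma>] dim by (meson not_le)
  qed
  have null: "\<gamma> y \<noteq> 0" if \<gamma>: "\<gamma> \<in> roots t" for \<gamma>
  proof
    assume "\<gamma> y = 0"
    moreover have "e \<in> weight_sum (\<lambda>\<gamma>. \<gamma> y = 1)"
      using eR weight_sum_mono[of R "\<lambda>\<gamma>. \<gamma> y = 1"] Ry by blast
    ultimately show False
      using dim_centralizer_null_root[OF l _ \<gamma>] dim by (meson not_le)
  qed
  show ni1: "n i = 1"
  proof (rule ccontr)
    assume "n i \<noteq> 1"
    then have n2: "n i > 1"
      using ni by simp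
    then have il: "i \<in> {1..l}"
      using i(1) mark_zero by (cases "i = 0") auto
    \<comment> \<open>The coefficient of \<alpha>_i in a root of \<open>R\<close> is 0 or -n_i, so
      the value 1/n_i becomes integral there, but not at \<alpha>_i itself.\<close>
    obtain u where u: "\<And>\<gamma>. \<gamma> \<in> roots t \<Longrightarrow>
        \<gamma> u = of_int (coeff_at \<gamma> i) * (1 / of_nat (n i)) + of_int (coeff_at \<gamma> i) * 0"
      using coefficient_element[of i "1 / of_nat (n i)" i 0] by blast
    have "\<gamma> u \<in> \<int>" if "R \<gamma>" for \<gamma>
      using that i ni by (auto simp: R_def u)
    then have "\<alpha> i u \<in> \<int>"
      using bound alpha_root[OF il] by blast
    then show False
      using u[OF alpha_root[OF il]] root_coeff_simple[OF il, of i] inverse_of_nat_not_int[OF n2, where 'a = 'k]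
      by simp
  qed
  show "p j = 1" if j: "j \<in> {0..l}" "j \<noteq> i"
  proof (rule ccontr)
    assume "p j \<noteq> 1"
    then consider "p j > 1" | "p j = 0"
      by linarith
    then show False
    proof cases
      case 1
      \<comment> \<open>On \<open>R\<close> the coefficients at j and i are both 0, or are -n_j and
        -n_i = -1 for negative roots; the values 1/2 and -n_j/2 make \<open>u\<close> vanish in
        either case. If j or i is 0, negative roots do not occur in \<open>R\<close> and the other
        coefficient is 0.\<close>
      obtain u where u: "\<And>\<gamma>. \<gamma> \<in> roots t \<Longrightarrow>
          \<gamma> u = of_int (coeff_at \<gamma> j) * (1 / 2) + of_int (coeff_at \<gamma> i) * (- of_nat (n j) / 2)"
        using coefficient_element[of j "1 / 2" i "- of_nat (n j) / 2"] by blast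
      have "\<gamma> u \<in> \<int>" if "R \<gamma>" for \<gamma>
        using that i j 1 ni1 by (auto simp: R_def u)
      then have *: "\<gamma> u \<in> \<int>" if "\<gamma> \<in> roots t" for \<gamma>
        using bound that by blast
      have half: "1 / of_nat 2 \<notin> (\<int> :: 'k set)"
        by (rule inverse_of_nat_not_int) simp
      show False
      proof (cases "j = 0")
        case True
        then have il: "i \<in> {1..l}"
          using i j by auto
        then have "\<alpha> i u = - (1 / of_nat 2)"
          using u[OF alpha_root[OF il]] root_coeff_simple[OF il] True mark_zero by simp
        then show False
          using *[OF alpha_root[OF il]] half by (metis minus_in_Ints_iff)
      next
        case False
        then have jl: "j \<in> {1..l}"
          using j by auto
        then have "\<alpha> j u = 1 / of_nat 2"
          using u[OF alpha_root[OF jl]] root_coeff_simple[OF jl] j by simp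
        then show False
          using *[OF alpha_root[OF jl]] half by metis
      qed
    next
      \<comment> \<open>The affine simple root \<alpha>_j has degree p_j = 0 at \<open>y\<close>.
        For j = 0 it is represented by \<delta>, whose degree is then m and whose value at
        \<open>y\<close> is m - m.\<close>
      case 2
      show False
      proof (cases "j = 0")
        case True
        then have il: "i \<in> {1..l}"
          using i j by auto
        have "int m - degree_of \<delta> = (\<Sum>k=0..l. (int (n k) - coeff_at \<delta> k) * int (p k))"
          by (rule order_minus_degree[OF delta_root])
        also have "\<dots> = 0"
        proof (intro sum.neutral ballI)
          fix k assume "k \<in> {0..l}"
          then show "(int (n k) - coeff_at \<delta> k) * int (p k) = 0"
            using mark_pos(1)[of k] 2 True by (cases "k = 0") auto
        qed
        finally have "degree_of \<delta> = int m"
          by simp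
        moreover have "coeff_at \<delta> i = 1"
          using mark_pos(1)[OF il] ni1 by simp
        ultimately show False
          using null[OF delta_root] y[OF delta_root] ni1 by simp
      next
        case False
        then have jl: "j \<in> {1..l}"
          using j by auto
        have "degree_of (\<alpha> j) = (\<Sum>k=1..l. if k = j then int (p k) else 0)"
          unfolding kac_degree_def by (rule sum.cong) (simp_all add: root_coeff_simple[OF jl])
        then have "degree_of (\<alpha> j) = 0"
          using jl 2 by (simp add: sum.delta)
        then show False
          using null[OF alpha_root[OF jl]] y[OF alpha_root[OF jl]] root_coeff_simple[OF jl, of i] j by simp
      qed
    qed
  qed
qed

end

section \<open>Transport along automorphisms\<close>

context cartan_setting
begin

lemma lie_automorphism_inv_br:
  assumes \<phi>: "lie_automorphism \<phi>"
  shows "br (inv \<phi> x) y = inv \<phi> (br x (\<phi> y))"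
proof -
  have b: "bij \<phi>" and h: "\<And>x y. \<phi> (br x y) = br (\<phi> x) (\<phi> y)"
    using \<phi> by (auto simp: lie_automorphism_def)
  have "\<phi> (br (inv \<phi> x) y) = br x (\<phi> y)"
    using h surj_f_inv_f[OF bij_is_surj[OF b]] by simp
  then show ?thesis
    using b by (metis bij_inv_eq_iff)
qed

lemma ad_nilpotent_inv:
  assumes \<phi>: "lie_automorphism \<phi>" and x: "ad_nilpotent x"
  shows "ad_nilpotent (inv \<phi> x)"
proof -
  have b: "bij \<phi>" and l: "lin \<phi>"
    using \<phi> by (auto simp: lie_automorphism_def)
  have i: "\<phi> (inv \<phi> z) = z" "inv \<phi> (\<phi> z) = z" for z
    using surj_f_inv_f[OF bij_is_surj[OF b]] inv_f_f[OF bij_is_inj[OF b]] by auto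
  obtain n where n: "\<And>y. (br x ^^ n) y = 0"
    using x by (auto simp: ad_nilpotent_def)
  have "(br (inv \<phi> x) ^^ k) y = inv \<phi> ((br x ^^ k) (\<phi> y))" for k y
    by (induction k) (simp_all add: i lie_automorphism_inv_br[OF \<phi>])
  then have "(br (inv \<phi> x) ^^ n) y = inv \<phi> (\<phi> 0)" for y
    by (simp add: n endo.linear_0[OF l])
  then show ?thesis
    using i by (auto simp: ad_nilpotent_def)
qed

lemma dim_centralizer_inv:
  assumes \<phi>: "lie_automorphism \<phi>"
  shows "dim (centralizer (inv \<phi> x)) \<le> dim (centralizer x)"
proof -
  have b: "bij \<phi>" and l: "lin \<phi>"
    using \<phi> by (auto simp: lie_automorphism_def)
  have "\<phi> ` centralizer (inv \<phi> x) \<subseteq> centralizer x"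
  proof
    fix z assume "z \<in> \<phi> ` centralizer (inv \<phi> x)"
    then obtain y where y: "z = \<phi> y" "br (inv \<phi> x) y = 0"
      by (auto simp: centralizer_def)
    then have "inv \<phi> (br x z) = 0"
      using lie_automorphism_inv_br[OF \<phi>] by simp
    then have "br x z = \<phi> 0"
      using surj_f_inv_f[OF bij_is_surj[OF b]] by metis
    then show "z \<in> centralizer x"
      by (simp add: centralizer_def endo.linear_0[OF l])
  qed
  then have "dim (\<phi> ` centralizer (inv \<phi> x)) \<le> dim (centralizer x)"
    by (rule dim_subset)
  moreover have "dim (\<phi> ` centralizer (inv \<phi> x)) = dim (centralizer (inv \<phi> x))"
    by (rule endo.dim_image_eq[OF l]) (use b bij_is_inj inj_on_subset in blast)
  ultimately show ?thesis
    by simp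
qed

end

theorem theorem7p10:
  fixes scale :: "'k::{alg_closed_field, field_char_0} \<Rightarrow> 'g::ab_group_add \<Rightarrow> 'g"
    and br :: "'g \<Rightarrow> 'g \<Rightarrow> 'g"
    and t :: "'g set" and l m :: nat
    and \<alpha> :: "nat \<Rightarrow> 'g \<Rightarrow> 'k" and \<delta> :: "'g \<Rightarrow> 'k" and n p :: "nat \<Rightarrow> nat"
    and \<zeta> :: 'k and \<theta> :: "'g \<Rightarrow> 'g"
  assumes "simple_lie_algebra scale br"
    and "lie_algebra.cartan_subalgebra scale br t"
    and "l = vector_space.dim scale t"
    and "lie_algebra.simple_roots scale br t l \<alpha>"
    and "lie_algebra.highest_root scale br t l \<alpha> \<delta>"
    and "n = mark t l \<alpha> \<delta>"
    and "lie_algebra.inner_automorphism scale br \<theta>"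
    and "has_order \<theta> m"
    and "primitive_root_of_unity m \<zeta>"
    and "lie_algebra.N_regular scale br \<zeta> \<theta>"
    and "lie_algebra.kac_labels scale br t l \<alpha> \<delta> \<zeta> p \<theta>"
  shows "(\<forall>i\<in>{0..l}. n i > 1 \<longrightarrow> p i \<in> {0, 1}) \<and>
    (\<forall>i\<in>{0..l}. n i = 1 \<and> p i > 1 \<longrightarrow> (\<forall>j\<in>{0..l}. j \<noteq> i \<longrightarrow> p j = 1))"
proof (cases "l = 0")
  \<comment> \<open>Only the index 0 exists, with mark 1, so both claims are vacuous. From rank 1 on
    there is a simple root, as nondegeneracy of the Killing form requires.\<close>
  case True
  then show ?thesis
    by (simp add: assms(6) mark_def)
next
  case False
  interpret S: simple_lie_algebra scale br
    by (rule assms(1))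
  obtain B0 where B0: "finite B0" "S.span B0 = UNIV"
    using S.finite_dimensional by blast
  obtain B where B: "B \<subseteq> B0" "S.independent B" "B0 \<subseteq> S.span B"
    using S.maximal_independent_subset by blast
  have "S.span B = UNIV"
    using S.span_minimal[OF B(3) S.subspace_span] B0(2) by auto
  then interpret C: cartan_setting scale br B t l \<alpha>
    using B finite_subset[OF B(1) B0(1)] assms(2,4) by unfold_locales auto
  interpret K: kac_setting scale br B t l \<alpha> \<delta> p "\<Sum>i=0..l. mark t l \<alpha> \<delta> i * p i"
    using assms(5) False by unfold_locales auto
  obtain x where x: "\<theta> x = scale \<zeta> x" "S.regular_nilpotent x"
    using assms(10) by (auto simp: S.N_regular_def S.eigenspace_def)
  obtain \<theta>\<^sub>p \<phi> where \<theta>: "S.kac_automorphism t l \<alpha> \<zeta> p \<theta>\<^sub>p" "S.lie_automorphism \<phi>" "\<theta> = \<phi> \<circ> \<theta>\<^sub>p \<circ> inv \<phi>"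
    and prim: "primitive_root_of_unity (\<Sum>i=0..l. mark t l \<alpha> \<delta> i * p i) \<zeta>"
    using assms(11) by (auto simp: S.kac_labels_def)
  have b: "bij \<phi>" and lin: "C.lin \<phi>"
    using \<theta>(2) by (auto simp: S.lie_automorphism_def)
  \<comment> \<open>Conjugation moves the eigenvector from \<open>\<theta>\<close> to
    \<open>\<theta>\<^sub>p\<close>, which acts by scalars on the weight spaces of
    \<open>t\<close>.\<close>
  let ?e = "inv \<phi> x"
  have "\<phi> (\<theta>\<^sub>p ?e) = \<phi> (scale \<zeta> ?e)"
    using x(1) \<theta>(3) surj_f_inv_f[OF bij_is_surj[OF b]] by (simp add: C.endo.linear_scale[OF lin])
  then have e: "\<theta>\<^sub>p ?e = scale \<zeta> ?e"
    using injD[OF bij_is_inj[OF b]] by blast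
  have nil: "S.ad_nilpotent ?e"
    using C.ad_nilpotent_inv[OF \<theta>(2)] x(2) by (simp add: S.regular_nilpotent_def)
  have dim: "S.dim (S.centralizer ?e) \<le> S.dim t"
    using C.dim_centralizer_inv[OF \<theta>(2), of x] C.dim_centralizer_regular[of x] x(2)
    by (simp add: S.regular_nilpotent_def)
  note labels = K.regular_nilpotent_labels[OF \<theta>(1) prim e nil dim]
  show ?thesis
    unfolding assms(6)
  proof (intro conjI ballI impI)
    fix i assume i: "i \<in> {0..l}" "mark t l \<alpha> \<delta> i > 1"
    have "\<not> p i > 1"
      using labels(1)[OF i(1)] i(2) by linarith
    then show "p i \<in> {0, 1}"
      by auto
  next
    fix i j assume "i \<in> {0..l}" "mark t l \<alpha> \<delta> i = 1 \<and> p i > 1" "j \<in> {0..l}" "j \<noteq> i"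
    then show "p j = 1"
      using labels(2)[of i j] by blast
  qed
qed

end
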